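(* Let $G$ be the graph of a rectangular warehouse with $m \ge 1$ aisles and $n$ cross-aisles, together with a pick list (including the depot). Suppose that either (i) the layout is single-block ($n = 2$), with any number of non-empty aisles; or (ii) the layout is two-block ($n = 3$), with two or more non-empty aisles. Then double edges are never required in a minimal tour; that is, there exists a minimum-length tour subgraph $T \subseteq G$ that contains no double edge (in any subaisle).
   Context: **Rectangular warehouse graph.** A rectangular warehouse has $m$ parallel vertical aisles, numbered $1,\dots,m$ from left to right, and $n \ge 2$ parallel horizontal cross-aisles, numbered $1,\dots,n$ from top to bottom. The aisle and cross-aisle crossings give intersection vertices $v_{i,j}$ ($1 \le i \le m$, $1 \le j \le n$). The part of aisle $i$ between the consecutive cross-aisles $j$ and $j+1$ (from $v_{i,j}$ to $v_{i,j+1}$) is called a subaisle. The region between two consecutive cross-aisles is a block, so the warehouse has $n-1$ blocks. Since the layout is rectangular, the distance between aisles $i$ and $i+1$ is a positive number $w_i$ that is the same along every cross-aisle, and the length of the subaisle between cross-aisles $j$ and $j+1$ is a positive number $h_j$ that is the same for every aisle. **Pick locations.** There is a finite set of required pick locations, one of which is the depot. Every pick location other than the depot lies strictly inside a subaisle. The depot may lie strictly inside a subaisle or coincide with an intersection vertex. An aisle is non-empty if it contains at least one pick location (the depot counts as a pick location). **The graph $G$.** The vertices of $G$ are the intersection vertices and the pick locations. Two vertices are adjacent if they are consecutive along an aisle (vertical adjacency) or if they are $v_{i,j}$ and $v_{i+1,j}$ for some $i,j$ (horizontal adjacency). Each adjacent pair is joined by two parallel edges, each of length equal to the distance between the two vertices.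 **Tour subgraphs.** A tour subgraph is a (multi-)subgraph $T \subseteq G$ such that (i) $T$ contains every pick location, including the depot, as a vertex; (ii) $T$ is connected; (iii) every vertex of $T$ has even degree in $T$ (counting parallel edges with multiplicity). The length of $T$ is the sum of the lengths of its edges, counted with multiplicity. A minimum-length tour subgraph (minimal tour) is a tour subgraph of least length. **Double edges.** A double edge of $T$ is a pair of parallel full traversals of one or more consecutive subaisles of the same aisle, with no horizontal edges of $T$ incident to the intermediate intersection vertices; that is, both parallel edges between every pair of consecutive vertices along these subaisles belong to $T$. Thus $T$ contains a double edge in a given subaisle (from $v_{i,j}$ to $v_{i,j+1}$) if and only if, for every two consecutive vertices of $G$ along that subaisle (including the end vertices $v_{i,j}$ and $v_{i,j+1}$), both parallel edges joining them belong to $T$. *)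

theory Defs
  imports Complex_Main
begin

(* Interior i j t lies on aisle i, at distance t below cross-aisle j, within the
   subaisle between cross-aisles j and j + 1. *)
datatype location =
    Crossing nat nat
  | Interior nat nat real

(* aisle_gap W i is the distance between aisles i and i + 1, subaisle_length W j the
   length of every subaisle between cross-aisles j and j + 1.  The depot is a member
   of picks. *)
record warehouse =
  aisles :: nat
  cross_aisles :: nat
  aisle_gap :: "nat \<Rightarrow> real"
  subaisle_length :: "nat \<Rightarrow> real"
  picks :: "location set"
  depot :: location

definition crossings :: "warehouse \<Rightarrow> location set" where
  "crossings W = {Crossing i j | i j. i \<in> {1..aisles W} \<and> j \<in> {1..cross_aisles W}}"

definition subaisle_interior :: "warehouse \<Rightarrow> location set" where
  "subaisle_interior W = {Interior i j t | i j t.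
     i \<in> {1..aisles W} \<and> j \<in> {1..<cross_aisles W} \<and> 0 < t \<and> t < subaisle_length W j}"

definition rectangular_warehouse :: "warehouse \<Rightarrow> bool" where
  "rectangular_warehouse W \<longleftrightarrow>
     1 \<le> aisles W \<and> 2 \<le> cross_aisles W \<and>
     (\<forall>i\<in>{1..<aisles W}. 0 < aisle_gap W i) \<and>
     (\<forall>j\<in>{1..<cross_aisles W}. 0 < subaisle_length W j) \<and>
     finite (picks W) \<and>
     depot W \<in> picks W \<and>
     depot W \<in> subaisle_interior W \<union> crossings W \<and>
     picks W - {depot W} \<subseteq> subaisle_interior W"

fun aisle_of :: "location \<Rightarrow> nat" where
  "aisle_of (Crossing i j) = i"
| "aisle_of (Interior i j t) = i"

(* distance from cross-aisle 1, measured downwards along the aisle *)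
fun depth :: "warehouse \<Rightarrow> location \<Rightarrow> real" where
  "depth W (Crossing i j) = (\<Sum>k = 1..<j. subaisle_length W k)"
| "depth W (Interior i j t) = (\<Sum>k = 1..<j. subaisle_length W k) + t"

definition nonempty_aisles :: "warehouse \<Rightarrow> nat set" where
  "nonempty_aisles W = {i \<in> {1..aisles W}. \<exists>p\<in>picks W. aisle_of p = i}"

(* Undirected multigraphs without loops.  An edge (u, v, b) joins u and v; the order of
   u and v carries no meaning, and b tells the two parallel edges apart. *)
record 'v multigraph =
  verts :: "'v set"
  edges :: "('v \<times> 'v \<times> bool) set"

definition subgraph :: "'v multigraph \<Rightarrow> 'v multigraph \<Rightarrow> bool" where
  "subgraph T G \<longleftrightarrow> verts T \<subseteq> verts G \<and> edges T \<subseteq> edges G \<and>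
     (\<forall>(u, v, b)\<in>edges T. u \<in> verts T \<and> v \<in> verts T)"

definition adjacency :: "'v multigraph \<Rightarrow> ('v \<times> 'v) set" where
  "adjacency T = {(u, v). \<exists>b. (u, v, b) \<in> edges T \<or> (v, u, b) \<in> edges T}"

definition connected_graph :: "'v multigraph \<Rightarrow> bool" where
  "connected_graph T \<longleftrightarrow> (\<forall>u\<in>verts T. \<forall>v\<in>verts T. (u, v) \<in> (adjacency T)\<^sup>*)"

definition degree :: "'v multigraph \<Rightarrow> 'v \<Rightarrow> nat" where
  "degree T x = card {(u, v, b) \<in> edges T. u = x \<or> v = x}"

definition warehouse_vertices :: "warehouse \<Rightarrow> location set" where
  "warehouse_vertices W = crossings W \<union> picks W"

(* u and v are consecutive along an aisle, u being the upper one *)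
definition vertical_adj :: "warehouse \<Rightarrow> location \<Rightarrow> location \<Rightarrow> bool" where
  "vertical_adj W u v \<longleftrightarrow>
     u \<in> warehouse_vertices W \<and> v \<in> warehouse_vertices W \<and>
     aisle_of u = aisle_of v \<and> depth W u < depth W v \<and>
     \<not> (\<exists>x\<in>warehouse_vertices W. aisle_of x = aisle_of u \<and>
          depth W u < depth W x \<and> depth W x < depth W v)"

(* u and v are consecutive along a cross-aisle, u being the left one *)
definition horizontal_adj :: "warehouse \<Rightarrow> location \<Rightarrow> location \<Rightarrow> bool" where
  "horizontal_adj W u v \<longleftrightarrow>
     (\<exists>i\<in>{1..<aisles W}. \<exists>j\<in>{1..cross_aisles W}. u = Crossing i j \<and> v = Crossing (i + 1) j)"

(* Each adjacent pair is listed in only one order (upper or left vertex first), so it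
   contributes exactly two parallel edges. *)
definition warehouse_graph :: "warehouse \<Rightarrow> location multigraph" where
  "warehouse_graph W = \<lparr>verts = warehouse_vertices W,
     edges = {(u, v, b). vertical_adj W u v \<or> horizontal_adj W u v}\<rparr>"

fun edge_length :: "warehouse \<Rightarrow> location \<times> location \<times> bool \<Rightarrow> real" where
  "edge_length W (u, v, b) =
     (if aisle_of u = aisle_of v then depth W v - depth W u else aisle_gap W (aisle_of u))"

definition tour_subgraph :: "warehouse \<Rightarrow> location multigraph \<Rightarrow> bool" where
  "tour_subgraph W T \<longleftrightarrow>
     subgraph T (warehouse_graph W) \<and> picks W \<subseteq> verts T \<and>
     connected_graph T \<and> (\<forall>x\<in>verts T. even (degree T x))"

definition tour_length :: "warehouse \<Rightarrow> location multigraph \<Rightarrow> real" where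
  "tour_length W T = (\<Sum>e\<in>edges T. edge_length W e)"

definition minimal_tour :: "warehouse \<Rightarrow> location multigraph \<Rightarrow> bool" where
  "minimal_tour W T \<longleftrightarrow> is_arg_min (tour_length W) (tour_subgraph W) T"

definition doubled_subaisle :: "warehouse \<Rightarrow> location multigraph \<Rightarrow> nat \<Rightarrow> nat \<Rightarrow> bool" where
  "doubled_subaisle W T i j \<longleftrightarrow>
     (\<forall>u v. vertical_adj W u v \<and> aisle_of u = i \<and>
            depth W (Crossing i j) \<le> depth W u \<and> depth W v \<le> depth W (Crossing i (j + 1))
        \<longrightarrow> (u, v, False) \<in> edges T \<and> (u, v, True) \<in> edges T)"

(* double edge of T on aisle i between the cross-aisles j < k *)
definition double_edge ::
    "warehouse \<Rightarrow> location multigraph \<Rightarrow> nat \<Rightarrow> nat \<Rightarrow> nat \<Rightarrow> bool" where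
  "double_edge W T i j k \<longleftrightarrow>
     i \<in> {1..aisles W} \<and> 1 \<le> j \<and> j < k \<and> k \<le> cross_aisles W \<and>
     (\<forall>l\<in>{j..<k}. doubled_subaisle W T i l) \<and>
     (\<forall>l\<in>{j<..<k}. \<forall>(u, v, b)\<in>edges T. horizontal_adj W u v \<longrightarrow>
        u \<noteq> Crossing i l \<and> v \<noteq> Crossing i l)"

(* A double edge over several subaisles contains one over a single subaisle. *)
lemma double_edge_iff_doubled_subaisle:
  "(\<exists>k. double_edge W T i j k) \<longleftrightarrow>
     i \<in> {1..aisles W} \<and> j \<in> {1..<cross_aisles W} \<and> doubled_subaisle W T i j"
proof
  assume "i \<in> {1..aisles W} \<and> j \<in> {1..<cross_aisles W} \<and> doubled_subaisle W T i j"
  then have "double_edge W T i j (j + 1)"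
    by (auto simp: double_edge_def)
  then show "\<exists>k. double_edge W T i j k" ..
qed (auto simp: double_edge_def)

end

theory Submission
  imports Defs
begin

text \<open>
  The proof is an exchange argument along rectangles. Among the tours of minimal length take one,
  called optimal, with the fewest doubled subaisles; call a pair of adjacent vertices a gap, and
  suppose that the subaisle of aisle \<open>i\<close> in block \<open>j\<close> is doubled. Let
  \<open>i'\<close> be a neighbouring aisle and consider the rectangle bounded by the aisles
  \<open>i\<close> and \<open>i'\<close> and by the cross-aisles \<open>j\<close> and \<open>j +
  1\<close>. Toggling one copy of every gap on this closed walk preserves all degree parities. If
  the copy is chosen so that multiplicities change by \<open>0 \<mapsto> 1\<close>, \<open>1
  \<mapsto> 2\<close>, \<open>2 \<mapsto> 1\<close>, then no used gap is lost; one single gap of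
  the rectangle may even change by \<open>1 \<mapsto> 0\<close>, because a cycle minus one gap is
  still connected (\<open>switch_is_tour\<close>). Aisle \<open>i\<close> saves the length of the
  subaisle, aisle \<open>i'\<close> costs at most the same length, since the layout is
  rectangular, and the two horizontal gaps can be made to cost nothing together if one of them was
  used. So the result is again a minimal tour, and optimality forces its subaisle of aisle
  \<open>i'\<close> to be doubled: a doubled subaisle can be moved to any neighbouring aisle to
  which the tour has a horizontal edge in that block, and that neighbour was traversed by single
  edges (\<open>move_doubled\<close>). If the horizontal edge is itself double, sacrificing one
  gap of the neighbour makes the tour strictly shorter
  (\<open>horizontal_gap_not_doubled\<close>).

  With two or three cross-aisles, every block has an end on the boundary of the warehouse.  At such
  an outer end of a doubled subaisle, the degree is even, double horizontal edges are excluded,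
  and a dead end can be cut off unless it is the depot.  Hence the tour leaves the outer end
  on both sides, unless it is the depot (\<open>doubled_reaches_both_sides\<close>).  A doubled subaisle
  that is not in the aisle of the depot can therefore be moved away from the depot again
  and again until it runs out of the warehouse, which is absurd.  So it lies in the
  aisle of the depot, has no horizontal edges at its two ends, and its outer end is the depot
  (\<open>doubled_hangs_from_depot\<close>).  In a single block both ends are outer, and they cannot both be
  the depot.  In two blocks, the tour leaves the depot through this aisle alone; since it must
  reach a pick in another aisle, parity across cuts shows that the other subaisle is
  doubled as well (\<open>hanging_gap_doubled\<close>), and then the depot would be at both ends of the aisle.
\<close>

section \<open>Degrees, cuts and symmetric differences in multigraphs\<close>

text \<open>The multiplicity of a gap, that is, of an adjacent pair of vertices, is the size of this set.\<close>

definition copies :: "'v multigraph \<Rightarrow> 'v \<times> 'v \<Rightarrow> bool set" where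
  "copies T p = {b. (fst p, snd p, b) \<in> edges T}"

lemma bool_set_cases: "(B :: bool set) = {} \<or> B = {True} \<or> B = {False} \<or> B = UNIV"
proof -
  have "B \<in> Pow {False, True}" by (simp add: UNIV_bool[symmetric])
  then show ?thesis unfolding UNIV_bool Pow_insert Pow_empty by blast
qed

fun incidence :: "'v \<Rightarrow> 'v \<times> 'v \<times> bool \<Rightarrow> nat" where
  "incidence x (u, v, b) = of_bool (u = x) + of_bool (v = x)"

lemma degree_eq_sum_incidence:
  assumes "finite (edges T)" and "\<And>u v b. (u, v, b) \<in> edges T \<Longrightarrow> u \<noteq> v"
  shows "degree T x = (\<Sum>e\<in>edges T. incidence x e)"
proof -
  have "degree T x = (\<Sum>e\<in>{(u, v, b) \<in> edges T. u = x \<or> v = x}. 1)"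
    by (simp add: degree_def)
  also have "\<dots> = (\<Sum>e\<in>edges T. incidence x e)"
    using assms(1) by (intro sum.mono_neutral_cong_left) (auto dest: assms(2))
  finally show ?thesis .
qed

text \<open>Adding two edge sets modulo two adds their degree parities.\<close>

lemma even_sum_sym_diff:
  fixes f :: "'a \<Rightarrow> nat"
  assumes "finite A" and "finite B"
  shows "even (sum f (sym_diff A B)) \<longleftrightarrow> (even (sum f A) \<longleftrightarrow> even (sum f B))"
proof -
  have "sum f A = sum f (A - B) + sum f (A \<inter> B)"
    using assms(1) by (metis sum.Int_Diff add.commute)
  moreover have "sum f B = sum f (B - A) + sum f (A \<inter> B)"
    using assms(2) by (metis sum.Int_Diff add.commute Int_commute)
  moreover have "sum f (sym_diff A B) = sum f (A - B) + sum f (B - A)"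
    using assms by (intro sum.union_disjoint) auto
  ultimately show ?thesis by presburger
qed

lemma sum_sym_diff_signed:
  fixes f :: "'a \<Rightarrow> real"
  assumes "finite A" and "finite B"
  shows "sum f (sym_diff A B) = sum f A + (\<Sum>e\<in>B. if e \<in> A then - f e else f e)"
proof -
  have A: "sum f A = sum f (A - B) + sum f (A \<inter> B)"
    using assms(1) by (metis sum.Int_Diff add.commute)
  have "(\<Sum>e\<in>B. if e \<in> A then - f e else f e)
      = (\<Sum>e\<in>B \<inter> A. if e \<in> A then - f e else f e) + (\<Sum>e\<in>B - A. if e \<in> A then - f e else f e)"
    using assms(2) by (rule sum.Int_Diff)
  also have "(\<Sum>e\<in>B \<inter> A. if e \<in> A then - f e else f e) = - sum f (A \<inter> B)"
    by (auto simp: sum_negf[symmetric] intro!: sum.cong)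
  also have "(\<Sum>e\<in>B - A. if e \<in> A then - f e else f e) = sum f (B - A)"
    by (auto intro!: sum.cong)
  moreover have "sum f (sym_diff A B) = sum f (A - B) + sum f (B - A)"
    using assms by (intro sum.union_disjoint) auto
  ultimately show ?thesis using A by simp
qed

text \<open>With \<open>f\<close> the identity this lifts connectedness to a graph with other edges; with \<open>f\<close> moving one
  vertex it contracts that vertex into another one.\<close>

lemma rtrancl_map:
  assumes "(x, y) \<in> r\<^sup>*" and "\<And>a b. (a, b) \<in> r \<Longrightarrow> (f a, f b) \<in> s\<^sup>*"
  shows "(f x, f y) \<in> s\<^sup>*"
  using assms(1) by induction (auto intro: rtrancl_trans assms(2))

lemma sym_adjacency_rtrancl: "sym ((adjacency T)\<^sup>*)"
  by (intro sym_rtrancl) (auto simp: sym_def adjacency_def)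

lemma adjacency_rtrancl_sym: "(x, y) \<in> (adjacency T)\<^sup>* \<Longrightarrow> (y, x) \<in> (adjacency T)\<^sup>*"
  using sym_adjacency_rtrancl by (rule symD)

lemma connected_crosses_cut:
  assumes "(x, y) \<in> (adjacency T)\<^sup>*" "x \<in> X" "y \<notin> X"
  obtains u v b where "(u, v, b) \<in> edges T" "(u \<in> X) \<noteq> (v \<in> X)"
proof -
  have "\<exists>u v. (u, v) \<in> adjacency T \<and> u \<in> X \<and> v \<notin> X"
    using assms by (induction rule: rtrancl_induct) auto
  then show thesis using that by (auto simp: adjacency_def)
qed

lemma sum_incidence_over:
  assumes "finite X"
  shows "(\<Sum>x\<in>X. incidence x (u, v, b)) = of_bool (u \<in> X) + of_bool (v \<in> X)"
  using assms by (simp add: sum.distrib of_bool_def)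

text \<open>Summing the degrees over \<open>X\<close> counts an edge inside \<open>X\<close> twice and a cut edge once.\<close>

lemma even_cut:
  assumes fin: "finite (edges T)" "finite X"
    and noloop: "\<And>u v b. (u, v, b) \<in> edges T \<Longrightarrow> u \<noteq> v"
    and even: "\<And>x. x \<in> X \<Longrightarrow> even (degree T x)"
  shows "even (card {(u, v, b) \<in> edges T. (u \<in> X) \<noteq> (v \<in> X)})"
proof -
  let ?C = "{(u, v, b) \<in> edges T. (u \<in> X) \<noteq> (v \<in> X)}"
  let ?w = "\<lambda>(u, v, b). of_bool (u \<in> X) + of_bool (v \<in> X) :: nat"
  have "(\<Sum>x\<in>X. degree T x) = (\<Sum>x\<in>X. \<Sum>e\<in>edges T. incidence x e)"
    using degree_eq_sum_incidence[OF fin(1) noloop] by simp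
  also have "\<dots> = (\<Sum>e\<in>edges T. \<Sum>x\<in>X. incidence x e)"
    by (rule sum.swap)
  also have "\<dots> = (\<Sum>e\<in>edges T. ?w e)"
    using sum_incidence_over[OF fin(2)] by (intro sum.cong) auto
  also have "\<dots> = (\<Sum>e\<in>edges T \<inter> ?C. ?w e) + (\<Sum>e\<in>edges T - ?C. ?w e)"
    using fin(1) by (rule sum.Int_Diff)
  also have "(\<Sum>e\<in>edges T \<inter> ?C. ?w e) = (\<Sum>e\<in>?C. 1)"
    by (intro sum.cong) auto
  finally have "(\<Sum>x\<in>X. degree T x) = card ?C + (\<Sum>e\<in>edges T - ?C. ?w e)" by simp
  moreover have "even (\<Sum>e\<in>edges T - ?C. ?w e)"
    by (intro dvd_sum) auto
  moreover have "even (\<Sum>x\<in>X. degree T x)" using even by (intro dvd_sum) auto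
  ultimately show ?thesis by simp
qed

text \<open>An even cut cannot consist of one edge, and connectedness excludes an empty cut.\<close>

lemma sole_cut_gap_is_doubled:
  assumes fin: "finite (edges T)" "finite X"
    and noloop: "\<And>u v b. (u, v, b) \<in> edges T \<Longrightarrow> u \<noteq> v"
    and even: "\<And>x. x \<in> X \<Longrightarrow> even (degree T x)"
    and conn: "(x, y) \<in> (adjacency T)\<^sup>*" "x \<in> X" "y \<notin> X"
    and sole: "\<And>u v b. (u, v, b) \<in> edges T \<Longrightarrow> (u \<in> X) \<noteq> (v \<in> X) \<Longrightarrow> (u, v) = p"
    and p: "(fst p \<in> X) \<noteq> (snd p \<in> X)"
  shows "copies T p = UNIV"
proof -
  have "{(u, v, b) \<in> edges T. (u \<in> X) \<noteq> (v \<in> X)} = (\<lambda>b. (fst p, snd p, b)) ` copies T p"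
    using sole p by (fastforce simp: copies_def)
  then have "even (card ((\<lambda>b. (fst p, snd p, b)) ` copies T p))"
    using even_cut[OF fin noloop even] by simp
  then have "even (card (copies T p))"
    by (subst (asm) card_image) (auto simp: inj_on_def)
  moreover have "copies T p \<noteq> {}"
  proof -
    obtain u v b where "(u, v, b) \<in> edges T" "(u \<in> X) \<noteq> (v \<in> X)"
      using connected_crosses_cut[OF conn] .
    then show ?thesis using sole by (fastforce simp: copies_def)
  qed
  moreover have "card (copies T p) \<le> 2"
    using card_mono[of "UNIV :: bool set" "copies T p"] by simp
  ultimately have "card (copies T p) = 2"
    by (metis One_nat_def card_eq_0_iff finite even_zero le_neq_implies_less less_2_cases odd_one)
  then show ?thesis
    by (intro card_subset_eq) auto
qed

section \<open>Geometry of the aisles\<close>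

locale warehouse_layout =
  fixes W :: warehouse
  assumes rect: "rectangular_warehouse W"
begin

(* Keeps the sums that express the depths of cross-aisles in one shape. *)
declare sum.op_ivl_Suc [simp del]

abbreviation V :: "location set" where "V \<equiv> warehouse_vertices W"
abbreviation G :: "location multigraph" where "G \<equiv> warehouse_graph W"
abbreviation cross_depth :: "nat \<Rightarrow> real" where "cross_depth j \<equiv> \<Sum>k = 1..<j. subaisle_length W k"

lemma subaisle_length_pos: "1 \<le> j \<Longrightarrow> j < cross_aisles W \<Longrightarrow> 0 < subaisle_length W j"
  using rect by (auto simp: rectangular_warehouse_def)

lemma aisle_gap_pos: "1 \<le> i \<Longrightarrow> i < aisles W \<Longrightarrow> 0 < aisle_gap W i"
  using rect by (auto simp: rectangular_warehouse_def)

lemma cross_depth_Suc: "1 \<le> j \<Longrightarrow> cross_depth (Suc j) = cross_depth j + subaisle_length W j"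
  by (simp add: sum.op_ivl_Suc)

lemma cross_depth_mono:
  assumes "1 \<le> j" "j \<le> k" "k \<le> cross_aisles W"
  shows "cross_depth j \<le> cross_depth k"
  using assms(2,1,3)
proof (induction k rule: dec_induct)
  case (step k)
  then show ?case using cross_depth_Suc[of k] subaisle_length_pos[of k] by simp
qed simp

lemma cross_depth_less: "1 \<le> j \<Longrightarrow> j < k \<Longrightarrow> k \<le> cross_aisles W \<Longrightarrow> cross_depth j < cross_depth k"
  using cross_depth_mono[of "Suc j" k] cross_depth_Suc[of j] subaisle_length_pos[of j] by simp

lemma vertex_cases:
  assumes "x \<in> V"
  obtains (Crossing) i j where "x = Crossing i j" "1 \<le> i" "i \<le> aisles W" "1 \<le> j" "j \<le> cross_aisles W"
  | (Interior) i j t where "x = Interior i j t" "1 \<le> i" "i \<le> aisles W" "1 \<le> j" "j < cross_aisles W"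
      "cross_depth j < cross_depth j + t" "cross_depth j + t < cross_depth (Suc j)"
proof -
  have "x \<in> crossings W \<or> x \<in> subaisle_interior W"
    using assms rect by (auto simp: warehouse_vertices_def rectangular_warehouse_def)
  then show thesis
    using that cross_depth_Suc by (auto simp: crossings_def subaisle_interior_def)
qed

lemma Crossing_in_V [simp]:
  "Crossing i j \<in> V \<longleftrightarrow> 1 \<le> i \<and> i \<le> aisles W \<and> 1 \<le> j \<and> j \<le> cross_aisles W"
  using rect by (auto simp: warehouse_vertices_def crossings_def rectangular_warehouse_def subaisle_interior_def)

lemma finite_V: "finite V"
proof -
  have "crossings W = (\<lambda>(i, j). Crossing i j) ` ({1..aisles W} \<times> {1..cross_aisles W})"
    by (auto simp: crossings_def)
  then show ?thesis
    using rect by (simp add: warehouse_vertices_def rectangular_warehouse_def)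
qed

text \<open>The picks in a subaisle lie strictly between its two ends, so different subaisles of an aisle
  share depths only at crossings.\<close>

lemma depth_inj:
  assumes "x \<in> V" "y \<in> V" "aisle_of x = aisle_of y" "depth W x = depth W y"
  shows "x = y"
proof -
  have CC: False if "cross_depth j = cross_depth k" "j < k" "1 \<le> j" "k \<le> cross_aisles W" for j k
    using cross_depth_less[of j k] that by simp
  have CI: False if "cross_depth j = cross_depth k + t" "cross_depth k < cross_depth k + t" "cross_depth k + t < cross_depth (Suc k)" "1 \<le> j" "1 \<le> k"
      "j \<le> cross_aisles W" "k < cross_aisles W" for j k t
    using cross_depth_mono[of j k] cross_depth_mono[of "Suc k" j] that by (cases "j \<le> k") auto
  have II: False if "cross_depth j + s = cross_depth k + t" "cross_depth k < cross_depth k + t" "cross_depth j + s < cross_depth (Suc j)" "1 \<le> j" "j < k"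
      "k < cross_aisles W" for j k s t
    using cross_depth_mono[of "Suc j" k] that by auto
  show ?thesis
    using assms(1)
  proof (cases rule: vertex_cases)
    case x: (Crossing i j)
    show ?thesis using assms(2)
    proof (cases rule: vertex_cases)
      case (Crossing i' k)
      then show ?thesis using x assms(3,4) CC[of j k] CC[of k j] by (cases j k rule: linorder_cases) auto
    next
      case (Interior i' k t)
      then show ?thesis using x assms(3,4) CI[of j k t] by auto
    qed
  next
    case x: (Interior i j s)
    show ?thesis using assms(2)
    proof (cases rule: vertex_cases)
      case (Crossing i' k)
      then show ?thesis using x assms(3,4) CI[of k j s] by auto
    next
      case (Interior i' k t)
      then show ?thesis using x assms(3,4) II[of j s k t] II[of k t j s]
        by (cases j k rule: linorder_cases) auto
    qed
  qed
qed

lemma vertex_below: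
  assumes "x \<in> V" "y \<in> V" "aisle_of x = aisle_of y" "depth W x < depth W y"
  obtains v where "vertical_adj W x v" "depth W v \<le> depth W y"
proof -
  let ?B = "{z \<in> V. aisle_of z = aisle_of x \<and> depth W x < depth W z}"
  define v where "v = arg_min_on (depth W) ?B"
  have fin: "finite ?B" "?B \<noteq> {}" using finite_V assms by auto
  have "v \<in> ?B" using arg_min_if_finite(1)[OF fin] by (simp add: v_def)
  moreover have "depth W v \<le> depth W z" if "z \<in> ?B" for z
    using arg_min_least[OF fin that] by (simp add: v_def)
  ultimately show thesis
    using that[of v] assms by (force simp: vertical_adj_def)
qed

lemma vertex_above:
  assumes "x \<in> V" "y \<in> V" "aisle_of x = aisle_of y" "depth W x < depth W y"
  obtains u where "vertical_adj W u y" "depth W x \<le> depth W u"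
proof -
  let ?B = "{z \<in> V. aisle_of z = aisle_of y \<and> depth W z < depth W y}"
  define u where "u = arg_min_on (\<lambda>z. - depth W z) ?B"
  have fin: "finite ?B" "?B \<noteq> {}" using finite_V assms by auto
  have "u \<in> ?B" using arg_min_if_finite(1)[OF fin] by (simp add: u_def)
  moreover have "depth W z \<le> depth W u" if "z \<in> ?B" for z
    using arg_min_least[OF fin that, of "\<lambda>z. - depth W z"] by (simp add: u_def)
  ultimately show thesis
    using that[of u] assms by (force simp: vertical_adj_def)
qed

lemma vertical_adj_unique_below: "vertical_adj W x v \<Longrightarrow> vertical_adj W x v' \<Longrightarrow> v = v'"
  using depth_inj[of v v'] by (force simp: vertical_adj_def)

lemma vertical_adj_unique_above: "vertical_adj W u x \<Longrightarrow> vertical_adj W u' x \<Longrightarrow> u = u'"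
  using depth_inj[of u u'] by (force simp: vertical_adj_def)

definition subaisle_gaps :: "nat \<Rightarrow> nat \<Rightarrow> (location \<times> location) set" where
  "subaisle_gaps i j = {(u, v). vertical_adj W u v \<and> aisle_of u = i \<and> cross_depth j \<le> depth W u \<and> depth W v \<le> cross_depth (Suc j)}"

definition subaisle :: "nat \<Rightarrow> nat \<Rightarrow> location set" where
  "subaisle i j = {x \<in> V. aisle_of x = i \<and> cross_depth j \<le> depth W x \<and> depth W x \<le> cross_depth (Suc j)}"

lemma doubled_iff: "doubled_subaisle W T i j \<longleftrightarrow> (\<forall>p\<in>subaisle_gaps i j. copies T p = UNIV)"
proof -
  have "copies T (u, v) = UNIV \<longleftrightarrow> (u, v, False) \<in> edges T \<and> (u, v, True) \<in> edges T" for u v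
    by (auto simp: copies_def set_eq_iff all_bool_eq)
  then show ?thesis
    unfolding doubled_subaisle_def subaisle_gaps_def depth.simps Suc_eq_plus1 by blast
qed

lemma finite_subaisle: "finite (subaisle i j)"
  using finite_V by (simp add: subaisle_def)

lemma subaisle_gaps_subset: "subaisle_gaps i j \<subseteq> subaisle i j \<times> subaisle i j"
  by (auto simp: subaisle_gaps_def subaisle_def vertical_adj_def)

lemma finite_subaisle_gaps: "finite (subaisle_gaps i j)"
  using finite_subset[OF subaisle_gaps_subset] finite_subaisle by blast

context
  fixes i j :: nat
  assumes i: "1 \<le> i" "i \<le> aisles W" and j: "1 \<le> j" "j < cross_aisles W"
begin

lemma corners_in_subaisle: "Crossing i j \<in> subaisle i j" "Crossing i (Suc j) \<in> subaisle i j"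
  using i j cross_depth_mono[of j "Suc j"] by (auto simp: subaisle_def)

text \<open>Gaps correspond to their upper ends and, by the companion lemma, to their lower ends.  This
  turns sums over the gaps of a subaisle into sums over its vertices, which replaces an induction
  along the subaisle.\<close>

lemma bij_betw_fst_subaisle_gaps: "bij_betw fst (subaisle_gaps i j) (subaisle i j - {Crossing i (Suc j)})"
  unfolding bij_betw_def
proof
  show "inj_on fst (subaisle_gaps i j)"
    by (auto simp: inj_on_def subaisle_gaps_def dest: vertical_adj_unique_below)
  show "fst ` subaisle_gaps i j = subaisle i j - {Crossing i (Suc j)}"
  proof (intro equalityI subsetI)
    fix x assume "x \<in> fst ` subaisle_gaps i j"
    then show "x \<in> subaisle i j - {Crossing i (Suc j)}"
      by (auto simp: subaisle_gaps_def subaisle_def vertical_adj_def)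
  next
    fix x assume x: "x \<in> subaisle i j - {Crossing i (Suc j)}"
    then have "depth W x < depth W (Crossing i (Suc j))"
      using depth_inj[of x "Crossing i (Suc j)"] i j by (force simp: subaisle_def)
    then obtain v where "vertical_adj W x v" "depth W v \<le> depth W (Crossing i (Suc j))"
      using x i j vertex_below[of x "Crossing i (Suc j)"] by (auto simp: subaisle_def)
    then have "(x, v) \<in> subaisle_gaps i j" using x by (auto simp: subaisle_gaps_def subaisle_def)
    then show "x \<in> fst ` subaisle_gaps i j" by force
  qed
qed

lemma bij_betw_snd_subaisle_gaps: "bij_betw snd (subaisle_gaps i j) (subaisle i j - {Crossing i j})"
  unfolding bij_betw_def
proof
  show "inj_on snd (subaisle_gaps i j)"
    by (auto simp: inj_on_def subaisle_gaps_def dest: vertical_adj_unique_above)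
  show "snd ` subaisle_gaps i j = subaisle i j - {Crossing i j}"
  proof (intro equalityI subsetI)
    fix x assume "x \<in> snd ` subaisle_gaps i j"
    then show "x \<in> subaisle i j - {Crossing i j}"
      by (force simp: subaisle_gaps_def subaisle_def vertical_adj_def)
  next
    fix x assume x: "x \<in> subaisle i j - {Crossing i j}"
    then have "depth W (Crossing i j) < depth W x"
      using depth_inj[of x "Crossing i j"] i j by (force simp: subaisle_def)
    then obtain u where "vertical_adj W u x" "depth W (Crossing i j) \<le> depth W u"
      using x i j vertex_above[of "Crossing i j" x] by (auto simp: subaisle_def)
    then have "(u, x) \<in> subaisle_gaps i j" using x by (auto simp: subaisle_gaps_def subaisle_def vertical_adj_def)
    then show "x \<in> snd ` subaisle_gaps i j" by force
  qed
qed

lemma subaisle_gaps_nonempty: "subaisle_gaps i j \<noteq> {}"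
  using bij_betw_fst_subaisle_gaps corners_in_subaisle(1) by (auto simp: bij_betw_def)

text \<open>The sum telescopes: every inner vertex is an upper end once and a lower end once.\<close>

lemma sum_subaisle_gaps_length: "(\<Sum>(u, v)\<in>subaisle_gaps i j. depth W v - depth W u) = subaisle_length W j"
proof -
  let ?S = "subaisle i j"
  have "(\<Sum>(u, v)\<in>subaisle_gaps i j. depth W v - depth W u)
      = (\<Sum>p\<in>subaisle_gaps i j. depth W (snd p)) - (\<Sum>p\<in>subaisle_gaps i j. depth W (fst p))"
    by (simp add: sum_subtractf case_prod_beta)
  also have "\<dots> = sum (depth W) (?S - {Crossing i j}) - sum (depth W) (?S - {Crossing i (Suc j)})"
    using sum.reindex_bij_betw[OF bij_betw_fst_subaisle_gaps, of "depth W"]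
      sum.reindex_bij_betw[OF bij_betw_snd_subaisle_gaps, of "depth W"] by simp
  also have "\<dots> = depth W (Crossing i (Suc j)) - depth W (Crossing i j)"
    using corners_in_subaisle finite_subaisle[of i j]
    by (simp add: sum_diff1 del: depth.simps)
  finally show ?thesis using cross_depth_Suc[OF j(1)] by simp
qed

text \<open>A subaisle is a path: its ends have degree one and its inner vertices degree two.  Adding
  the ends once more makes all of these degrees two, a form in which the four corners of a rectangle cancel.\<close>

lemma sum_subaisle_gaps_incidence:
  "(\<Sum>(u, v)\<in>subaisle_gaps i j. incidence x (u, v, b)) + of_bool (x = Crossing i j) + of_bool (x = Crossing i (Suc j))
     = 2 * of_bool (x \<in> subaisle i j)"
proof -
  let ?S = "subaisle i j"
  have *: "(\<Sum>y\<in>?S - {c}. of_bool (y = x)) = (of_bool (x \<in> ?S - {c}) :: nat)" for c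
    using finite_subaisle[of i j] by (simp add: of_bool_def)
  have "(\<Sum>(u, v)\<in>subaisle_gaps i j. incidence x (u, v, b))
      = (\<Sum>p\<in>subaisle_gaps i j. of_bool (fst p = x)) + (\<Sum>p\<in>subaisle_gaps i j. of_bool (snd p = x))"
    by (simp add: sum.distrib case_prod_beta)
  also have "\<dots> = of_bool (x \<in> ?S - {Crossing i (Suc j)}) + of_bool (x \<in> ?S - {Crossing i j})"
    using sum.reindex_bij_betw[OF bij_betw_fst_subaisle_gaps, of "\<lambda>y. of_bool (y = x) :: nat"]
      sum.reindex_bij_betw[OF bij_betw_snd_subaisle_gaps, of "\<lambda>y. of_bool (y = x) :: nat"] * by simp
  finally show ?thesis using corners_in_subaisle by auto
qed

end

section \<open>Elementary properties of tours\<close>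

lemma edges_G: "(u, v, b) \<in> edges G \<longleftrightarrow> vertical_adj W u v \<or> horizontal_adj W u v"
  by (simp add: warehouse_graph_def)

lemma horizontal_adj_iff:
  "horizontal_adj W u v \<longleftrightarrow>
     (\<exists>l j. u = Crossing l j \<and> v = Crossing (Suc l) j \<and> 1 \<le> l \<and> l < aisles W \<and> 1 \<le> j \<and> j \<le> cross_aisles W)"
  by (auto simp: horizontal_adj_def)

lemma G_edge_ends: "(u, v, b) \<in> edges G \<Longrightarrow> u \<in> V \<and> v \<in> V \<and> u \<noteq> v"
  by (auto simp: edges_G horizontal_adj_iff vertical_adj_def)

lemma finite_edges_G: "finite (edges G)"
proof (rule finite_subset)
  show "edges G \<subseteq> V \<times> V \<times> UNIV" using G_edge_ends by auto
qed (simp add: finite_V)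

lemma edge_length_pos: "e \<in> edges G \<Longrightarrow> 0 < edge_length W e"
  by (cases e) (auto simp: edges_G horizontal_adj_iff vertical_adj_def aisle_gap_pos)

lemma tour_edges:
  assumes "tour_subgraph W T"
  shows "finite (edges T)" and "(u, v, b) \<in> edges T \<Longrightarrow> (u, v, b) \<in> edges G"
    and "(u, v, b) \<in> edges T \<Longrightarrow> u \<noteq> v"
    and "(u, v, b) \<in> edges T \<Longrightarrow> u \<in> verts T \<and> v \<in> verts T"
    and "verts T \<subseteq> V" and "edges T \<subseteq> edges G"
proof -
  show *: "edges T \<subseteq> edges G" "verts T \<subseteq> V"
    using assms by (auto simp: tour_subgraph_def subgraph_def warehouse_graph_def)
  then show "finite (edges T)" using finite_edges_G finite_subset by blast
  show "(u, v, b) \<in> edges T \<Longrightarrow> (u, v, b) \<in> edges G" using * by auto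
  then show "(u, v, b) \<in> edges T \<Longrightarrow> u \<noteq> v" using G_edge_ends by auto
  show "(u, v, b) \<in> edges T \<Longrightarrow> u \<in> verts T \<and> v \<in> verts T"
    using assms by (auto simp: tour_subgraph_def subgraph_def)
qed

lemma tour_degree:
  assumes "tour_subgraph W T"
  shows "degree T x = (\<Sum>e\<in>edges T. incidence x e)"
  using degree_eq_sum_incidence tour_edges[OF assms] by metis

lemma tour_degree_even:
  assumes "tour_subgraph W T"
  shows "even (degree T x)"
proof (cases "x \<in> verts T")
  case True
  then show ?thesis using assms by (simp add: tour_subgraph_def)
next
  case False
  then have "{(u, v, b) \<in> edges T. u = x \<or> v = x} = {}"
    using tour_edges(4)[OF assms] by auto
  then show ?thesis by (simp only: degree_def card.empty even_zero)
qed

lemma tour_connected: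
  "tour_subgraph W T \<Longrightarrow> x \<in> verts T \<Longrightarrow> y \<in> verts T \<Longrightarrow> (x, y) \<in> (adjacency T)\<^sup>*"
  by (simp add: tour_subgraph_def connected_graph_def)

lemma adjacency_copies: "copies T p \<noteq> {} \<Longrightarrow> (fst p, snd p) \<in> adjacency T"
  by (auto simp: copies_def adjacency_def)

lemma used_gap_ends:
  assumes "tour_subgraph W T" "copies T p \<noteq> {}"
  shows "fst p \<in> verts T" "snd p \<in> verts T"
  using tour_edges(4)[OF assms(1)] assms(2) by (auto simp: copies_def)

section \<open>Switching a tour along a rectangle\<close>

definition horizontal_gap :: "nat \<Rightarrow> nat \<Rightarrow> location \<times> location" where
  "horizontal_gap l j = (Crossing l j, Crossing (Suc l) j)"

definition rectangle :: "nat \<Rightarrow> nat \<Rightarrow> (location \<times> location) set" where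
  "rectangle l j = subaisle_gaps l j \<union> subaisle_gaps (Suc l) j \<union> {horizontal_gap l j, horizontal_gap l (Suc j)}"

definition gap_length :: "location \<times> location \<Rightarrow> real" where
  "gap_length p = edge_length W (fst p, snd p, True)"

lemma sum_gap_length_subaisle_gaps:
  assumes "1 \<le> i" "i \<le> aisles W" "1 \<le> j" "j < cross_aisles W"
  shows "(\<Sum>p\<in>subaisle_gaps i j. gap_length p) = subaisle_length W j"
proof -
  have "(\<Sum>p\<in>subaisle_gaps i j. gap_length p) = (\<Sum>(u, v)\<in>subaisle_gaps i j. depth W v - depth W u)"
    by (intro sum.cong) (auto simp: gap_length_def subaisle_gaps_def vertical_adj_def)
  then show ?thesis using sum_subaisle_gaps_length[OF assms] by simp
qed

lemma gap_length_horizontal_gap: "gap_length (horizontal_gap l j) = aisle_gap W l"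
  by (simp add: gap_length_def horizontal_gap_def)

lemma gap_length_pos: "p \<in> subaisle_gaps i j \<Longrightarrow> 0 < gap_length p"
  by (auto simp: gap_length_def subaisle_gaps_def vertical_adj_def)

text \<open>Only the gaps above \<open>x\<close> are assumed to be used, so that the lemma also applies to a subaisle
  that is interrupted below \<open>x\<close>.\<close>

lemma connected_to_upper_end:
  assumes ij: "1 \<le> i" "i \<le> aisles W" "1 \<le> j" "j < cross_aisles W"
    and x: "x \<in> subaisle i j"
    and used: "\<And>p. p \<in> subaisle_gaps i j \<Longrightarrow> depth W (snd p) \<le> depth W x \<Longrightarrow> copies T p \<noteq> {}"
  shows "(Crossing i j, x) \<in> (adjacency T)\<^sup>*"
  using x used
proof (induction "card {y \<in> subaisle i j. depth W y < depth W x}" arbitrary: x rule: less_induct)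
  case less
  show ?case
  proof (cases "x = Crossing i j")
    case False
    then have "x \<in> snd ` subaisle_gaps i j"
      using bij_betw_snd_subaisle_gaps[OF ij] less.prems(1) by (simp add: bij_betw_def)
    then obtain u where u: "(u, x) \<in> subaisle_gaps i j" by force
    then have du: "depth W u < depth W x" and uS: "u \<in> subaisle i j"
      by (auto simp: subaisle_gaps_def vertical_adj_def subaisle_def)
    have "{y \<in> subaisle i j. depth W y < depth W u} \<subset> {y \<in> subaisle i j. depth W y < depth W x}"
      using du uS by auto
    then have "card {y \<in> subaisle i j. depth W y < depth W u} < card {y \<in> subaisle i j. depth W y < depth W x}"
      using finite_subaisle by (intro psubset_card_mono) simp
    then have "(Crossing i j, u) \<in> (adjacency T)\<^sup>*"
      using uS
    proof (rule less.hyps)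
      fix p assume "p \<in> subaisle_gaps i j" "depth W (snd p) \<le> depth W u"
      then show "copies T p \<noteq> {}" using less.prems(2)[of p] du by linarith
    qed
    then show ?thesis
      using adjacency_copies[of T "(u, x)"] less.prems(2)[OF u] by auto
  qed simp
qed

lemma connected_to_lower_end:
  assumes ij: "1 \<le> i" "i \<le> aisles W" "1 \<le> j" "j < cross_aisles W"
    and x: "x \<in> subaisle i j"
    and used: "\<And>p. p \<in> subaisle_gaps i j \<Longrightarrow> depth W x \<le> depth W (fst p) \<Longrightarrow> copies T p \<noteq> {}"
  shows "(x, Crossing i (Suc j)) \<in> (adjacency T)\<^sup>*"
  using x used
proof (induction "card {y \<in> subaisle i j. depth W x < depth W y}" arbitrary: x rule: less_induct)
  case less
  show ?case
  proof (cases "x = Crossing i (Suc j)")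
    case False
    then have "x \<in> fst ` subaisle_gaps i j"
      using bij_betw_fst_subaisle_gaps[OF ij] less.prems(1) by (simp add: bij_betw_def)
    then obtain v where v: "(x, v) \<in> subaisle_gaps i j" by force
    then have dv: "depth W x < depth W v" and vS: "v \<in> subaisle i j"
      by (auto simp: subaisle_gaps_def vertical_adj_def subaisle_def)
    have "{y \<in> subaisle i j. depth W v < depth W y} \<subset> {y \<in> subaisle i j. depth W x < depth W y}"
      using dv vS by auto
    then have "card {y \<in> subaisle i j. depth W v < depth W y} < card {y \<in> subaisle i j. depth W x < depth W y}"
      using finite_subaisle by (intro psubset_card_mono) simp
    then have "(v, Crossing i (Suc j)) \<in> (adjacency T)\<^sup>*"
      using vS
    proof (rule less.hyps)
      fix p assume "p \<in> subaisle_gaps i j" "depth W v \<le> depth W (fst p)"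
      then show "copies T p \<noteq> {}" using less.prems(2)[of p] dv by linarith
    qed
    then show ?thesis
      using adjacency_copies[of T "(x, v)"] less.prems(2)[OF v]
      by (auto intro: converse_rtrancl_into_rtrancl)
  qed simp
qed

text \<open>The gap \<open>z\<close> cannot lie both above and below \<open>x\<close>.\<close>

lemma subaisle_minus_gap_connected:
  assumes ij: "1 \<le> i" "i \<le> aisles W" "1 \<le> j" "j < cross_aisles W"
    and x: "x \<in> subaisle i j"
    and used: "\<And>p. p \<in> subaisle_gaps i j \<Longrightarrow> p \<noteq> z \<Longrightarrow> copies T p \<noteq> {}"
  shows "(Crossing i j, x) \<in> (adjacency T)\<^sup>* \<or> (Crossing i (Suc j), x) \<in> (adjacency T)\<^sup>*"
proof (cases "z \<in> subaisle_gaps i j \<and> depth W (snd z) \<le> depth W x")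
  case True
  have "depth W (fst z) < depth W (snd z)"
    using True by (simp add: subaisle_gaps_def vertical_adj_def case_prod_beta)
  with True have z: "depth W (fst z) < depth W x" by linarith
  have "(x, Crossing i (Suc j)) \<in> (adjacency T)\<^sup>*"
  proof (rule connected_to_lower_end[OF ij x])
    fix p assume p: "p \<in> subaisle_gaps i j" "depth W x \<le> depth W (fst p)"
    then have "p \<noteq> z" using z by (metis not_le)
    then show "copies T p \<noteq> {}" by (rule used[OF p(1)])
  qed
  then show ?thesis by (rule disjI2[OF adjacency_rtrancl_sym])
next
  case False
  have "(Crossing i j, x) \<in> (adjacency T)\<^sup>*"
  proof (rule connected_to_upper_end[OF ij x])
    fix p assume p: "p \<in> subaisle_gaps i j" "depth W (snd p) \<le> depth W x"
    then have "p \<noteq> z" using False by metis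
    then show "copies T p \<noteq> {}" by (rule used[OF p(1)])
  qed
  then show ?thesis ..
qed

text \<open>A cycle stays connected when one gap is removed.\<close>

lemma rectangle_minus_gap_connected:
  assumes l: "1 \<le> l" "l < aisles W" and j: "1 \<le> j" "j < cross_aisles W"
    and used: "\<And>p. p \<in> rectangle l j \<Longrightarrow> p \<noteq> z \<Longrightarrow> copies T p \<noteq> {}"
    and x: "x \<in> subaisle l j \<union> subaisle (Suc l) j"
    and y: "y \<in> subaisle l j \<union> subaisle (Suc l) j"
  shows "(x, y) \<in> (adjacency T)\<^sup>*"
proof -
  let ?R = "\<lambda>x y. (x, y) \<in> (adjacency T)\<^sup>*"
  have sy: "?R a b \<Longrightarrow> ?R b a" for a b by (rule adjacency_rtrancl_sym)
  have tr: "?R a b \<Longrightarrow> ?R b c \<Longrightarrow> ?R a c" for a b c by (rule rtrancl_trans)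
  have Sl: "1 \<le> Suc l" "Suc l \<le> aisles W" "l \<le> aisles W" using l by auto
  have h1: "?R (Crossing l j) (Crossing (Suc l) j)" if "z \<noteq> horizontal_gap l j"
    using adjacency_copies[OF used[of "horizontal_gap l j"]] that by (auto simp: rectangle_def horizontal_gap_def)
  have h2: "?R (Crossing l (Suc j)) (Crossing (Suc l) (Suc j))" if "z \<noteq> horizontal_gap l (Suc j)"
    using adjacency_copies[OF used[of "horizontal_gap l (Suc j)"]] that by (auto simp: rectangle_def horizontal_gap_def)
  have v: "?R (Crossing i j) (Crossing i (Suc j))"
    if "z \<notin> subaisle_gaps i j" "i \<in> {l, Suc l}" for i
    using that used l Sl
    by (intro connected_to_lower_end[OF _ _ j] corners_in_subaisle[OF _ _ j]) (auto simp: rectangle_def)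
  have distinct: "horizontal_gap l j \<noteq> horizontal_gap l (Suc j)" "horizontal_gap l k \<notin> subaisle_gaps i j" "subaisle_gaps l j \<inter> subaisle_gaps (Suc l) j = {}"
    for k i by (auto simp: horizontal_gap_def subaisle_gaps_def vertical_adj_def)
  let ?A = "Crossing l j" and ?B = "Crossing (Suc l) j"
    and ?C = "Crossing l (Suc j)" and ?D = "Crossing (Suc l) (Suc j)"
  \<comment> \<open>The four sides of the rectangle, at most one of which is broken by \<open>z\<close>.\<close>
  have three: "?R ?A ?B \<and> ?R ?A ?C \<and> ?R ?B ?D \<or> ?R ?A ?B \<and> ?R ?A ?C \<and> ?R ?C ?D
      \<or> ?R ?A ?B \<and> ?R ?B ?D \<and> ?R ?C ?D \<or> ?R ?A ?C \<and> ?R ?B ?D \<and> ?R ?C ?D"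
    using distinct h1 h2 v[of l] v[of "Suc l"] by auto
  have AD: "?R ?A ?D"
    using three tr[of ?A ?B ?D] tr[of ?A ?C ?D] by argo
  have AB: "?R ?A ?B"
    using three AD tr[of ?A ?D ?B] sy[of ?B ?D] by argo
  have AC: "?R ?A ?C"
    using three AD tr[of ?A ?D ?C] sy[of ?C ?D] by argo
  have corners: "?R ?A (Crossing i k)" if "i \<in> {l, Suc l}" "k \<in> {j, Suc j}" for i k
    using that AB AC AD by auto
  have A: "?R ?A x" if x: "x \<in> subaisle l j \<union> subaisle (Suc l) j" for x
  proof -
    obtain i where i: "i \<in> {l, Suc l}" "x \<in> subaisle i j" using x by blast
    then have "?R (Crossing i j) x \<or> ?R (Crossing i (Suc j)) x"
      using l Sl used by (intro subaisle_minus_gap_connected[OF _ _ j, of _ _ z]) (auto simp: rectangle_def)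
    then show ?thesis
      using tr[OF corners[OF i(1), of j]] tr[OF corners[OF i(1), of "Suc j"]] by auto
  qed
  then show ?thesis using tr[OF sy[OF A[OF x]] A[OF y]] by blast
qed

text \<open>The copy of the gap \<open>p\<close> that is toggled: the multiplicity changes by \<open>0 \<mapsto> 1\<close>, \<open>1 \<mapsto> 2\<close> and \<open>2 \<mapsto> 1\<close>,
  except that a single edge at the gap \<open>z\<close> is removed.\<close>

definition switch_copy :: "location multigraph \<Rightarrow> location \<times> location \<Rightarrow> location \<times> location \<Rightarrow> bool" where
  "switch_copy T z p = (if p = z then True \<in> copies T p else copies T p = {False})"

definition toggled :: "location multigraph \<Rightarrow> nat \<Rightarrow> nat \<Rightarrow> location \<times> location \<Rightarrow> (location \<times> location \<times> bool) set" where
  "toggled T l j z = (\<lambda>p. (fst p, snd p, switch_copy T z p)) ` rectangle l j"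

text \<open>The vertices of both subaisles are added since the switched tour runs through all of them.\<close>

definition switch :: "location multigraph \<Rightarrow> nat \<Rightarrow> nat \<Rightarrow> location \<times> location \<Rightarrow> location multigraph" where
  "switch T l j z = \<lparr>verts = verts T \<union> subaisle l j \<union> subaisle (Suc l) j,
     edges = sym_diff (edges T) (toggled T l j z)\<rparr>"

lemma copies_switch_outside: "p \<notin> rectangle l j \<Longrightarrow> copies (switch T l j z) p = copies T p"
  by (auto simp: copies_def switch_def toggled_def prod_eq_iff)

lemma copies_switch_inside:
  "p \<in> rectangle l j \<Longrightarrow> copies (switch T l j z) p = sym_diff (copies T p) {switch_copy T z p}"
  unfolding set_eq_iff by (auto simp: copies_def switch_def toggled_def prod_eq_iff image_iff)

lemma copies_switch_nonempty:
  assumes "p \<in> rectangle l j" "p \<noteq> z"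
  shows "copies (switch T l j z) p \<noteq> {}"
  using bool_set_cases[of "copies T p"] assms
  by (auto simp: copies_switch_inside switch_copy_def UNIV_bool)

lemma copies_switch_full:
  assumes "p \<in> rectangle l j" "p \<noteq> z"
  shows "copies (switch T l j z) p = UNIV \<longleftrightarrow> copies T p = {True} \<or> copies T p = {False}"
  using bool_set_cases[of "copies T p"] assms
  by (auto simp: copies_switch_inside switch_copy_def UNIV_bool)

text \<open>The change of length that the switch causes at the gap \<open>p\<close>.\<close>

definition signed_length :: "location multigraph \<Rightarrow> location \<times> location \<Rightarrow> location \<times> location \<Rightarrow> real" where
  "signed_length T z p = (if switch_copy T z p \<in> copies T p then - gap_length p else gap_length p)"

context
  fixes l j :: nat
  assumes l: "1 \<le> l" "l < aisles W" and j: "1 \<le> j" "j < cross_aisles W"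
begin

lemma rectangle_in_G: "p \<in> rectangle l j \<Longrightarrow> (fst p, snd p, b) \<in> edges G"
  using l j by (auto simp: rectangle_def subaisle_gaps_def edges_G horizontal_gap_def horizontal_adj_iff)

lemma rectangle_ends:
  assumes "p \<in> rectangle l j"
  shows "fst p \<in> subaisle l j \<union> subaisle (Suc l) j" "snd p \<in> subaisle l j \<union> subaisle (Suc l) j"
  using assms subaisle_gaps_subset[of l j] subaisle_gaps_subset[of "Suc l" j] corners_in_subaisle[of l j]
    corners_in_subaisle[of "Suc l" j] l j
  by (auto simp: rectangle_def horizontal_gap_def)

lemma sum_rectangle:
  "sum f (rectangle l j) = sum f (subaisle_gaps l j) + sum f (subaisle_gaps (Suc l) j) + f (horizontal_gap l j) + f (horizontal_gap l (Suc j))"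
    for f :: "_ \<Rightarrow> 'a :: comm_monoid_add"
proof -
  have "subaisle_gaps l j \<inter> subaisle_gaps (Suc l) j = {}"
    and "(subaisle_gaps l j \<union> subaisle_gaps (Suc l) j) \<inter> {horizontal_gap l j, horizontal_gap l (Suc j)} = {}"
    and "horizontal_gap l j \<noteq> horizontal_gap l (Suc j)"
    by (auto simp: horizontal_gap_def subaisle_gaps_def vertical_adj_def)
  then show ?thesis
    by (simp add: rectangle_def sum.union_disjoint finite_subaisle_gaps ac_simps)
qed

lemma finite_rectangle: "finite (rectangle l j)"
  by (simp add: rectangle_def finite_subaisle_gaps)

lemma sum_toggled: "sum f (toggled T l j z) = (\<Sum>p\<in>rectangle l j. f (fst p, snd p, switch_copy T z p))"
  by (simp add: toggled_def sum.reindex inj_on_def prod_eq_iff)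

text \<open>The toggled edges form a cycle.\<close>

lemma even_incidence_toggled: "even (\<Sum>e\<in>toggled T l j z. incidence x e)"
proof -
  have "(\<Sum>e\<in>toggled T l j z. incidence x e) = (\<Sum>p\<in>rectangle l j. incidence x (fst p, snd p, True))"
    by (simp add: sum_toggled)
  also have "\<dots> = 2 * of_bool (x \<in> subaisle l j) + 2 * of_bool (x \<in> subaisle (Suc l) j)"
    using sum_subaisle_gaps_incidence[of l j x True] sum_subaisle_gaps_incidence[of "Suc l" j x True] l j
    by (simp add: sum_rectangle case_prod_beta horizontal_gap_def eq_commute[of x])
  finally show ?thesis by simp
qed

text \<open>Parities are preserved because a cycle is added modulo two.  Connectedness is preserved because
  the only gap that can get lost is \<open>z\<close>, and its ends remain joined by the rest of the rectangle.  The
  vertex \<open>w\<close> ties the rectangle to the rest of the tour.\<close>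

lemma switch_is_tour:
  assumes T: "tour_subgraph W T" and meets: "w \<in> verts T" "w \<in> subaisle l j \<union> subaisle (Suc l) j"
  shows "tour_subgraph W (switch T l j z)"
proof -
  let ?T' = "switch T l j z" and ?S = "subaisle l j \<union> subaisle (Suc l) j"
  have finF: "finite (toggled T l j z)" using finite_rectangle by (simp add: toggled_def)
  have FG: "toggled T l j z \<subseteq> edges G" using rectangle_in_G by (auto simp: toggled_def)
  have sub: "subgraph ?T' G"
    unfolding subgraph_def
  proof (intro conjI)
    show "verts ?T' \<subseteq> verts G"
      using tour_edges(5)[OF T] by (auto simp: switch_def warehouse_graph_def subaisle_def)
    show E: "edges ?T' \<subseteq> edges G"
      using tour_edges(6)[OF T] FG by (auto simp: switch_def)
    show "\<forall>(u, v, b)\<in>edges ?T'. u \<in> verts ?T' \<and> v \<in> verts ?T'"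
    proof clarify
      fix u v b assume "(u, v, b) \<in> edges ?T'"
      then have "(u, v, b) \<in> edges T \<or> (u, v) \<in> rectangle l j"
        by (auto simp: switch_def toggled_def)
      then show "u \<in> verts ?T' \<and> v \<in> verts ?T'"
        using tour_edges(4)[OF T, of u v b] rectangle_ends[of "(u, v)"] by (auto simp: switch_def)
    qed
  qed
  then have E': "edges ?T' \<subseteq> edges G" by (simp add: subgraph_def)
  have deg: "even (degree ?T' x)" for x
  proof -
    have "degree ?T' x = (\<Sum>e\<in>edges ?T'. incidence x e)"
    proof (rule degree_eq_sum_incidence)
      show "finite (edges ?T')" using E' finite_edges_G by (rule finite_subset)
      show "u \<noteq> v" if "(u, v, b) \<in> edges ?T'" for u v b
        using G_edge_ends[of u v b] that E' by blast
    qed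
    also have "\<dots> = (\<Sum>e\<in>sym_diff (edges T) (toggled T l j z). incidence x e)"
      by (simp add: switch_def)
    finally show ?thesis
      using even_sum_sym_diff[OF tour_edges(1)[OF T] finF] even_incidence_toggled
        tour_degree_even[OF T, of x] tour_degree[OF T, of x] by simp
  qed
  have S: "(x, y) \<in> (adjacency ?T')\<^sup>*" if "x \<in> ?S" "y \<in> ?S" for x y
    using copies_switch_nonempty by (rule rectangle_minus_gap_connected[OF l j _ that])
  have step: "(a, b) \<in> (adjacency ?T')\<^sup>*" if "(a, b, c) \<in> edges T" for a b c
  proof (cases "copies ?T' (a, b) = {}")
    case True
    then have "(a, b) \<in> rectangle l j"
      using that copies_switch_outside[of "(a, b)" l j T z] by (auto simp: copies_def[of T])
    then show ?thesis using rectangle_ends[of "(a, b)"] by (intro S) simp_all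
  next
    case False
    then show ?thesis using adjacency_copies[of ?T' "(a, b)"] by auto
  qed
  have w: "(w, x) \<in> (adjacency ?T')\<^sup>*" if "x \<in> verts ?T'" for x
  proof (cases "x \<in> ?S")
    case True
    show ?thesis using meets(2) True by (rule S)
  next
    case False
    then have "(w, x) \<in> (adjacency T)\<^sup>*"
      using that meets tour_connected[OF T] by (auto simp: switch_def)
    then show ?thesis
    proof (rule rtrancl_map[of _ _ _ "\<lambda>x. x"])
      fix a b assume "(a, b) \<in> adjacency T"
      then obtain c where "(a, b, c) \<in> edges T \<or> (b, a, c) \<in> edges T"
        by (auto simp: adjacency_def)
      then show "(a, b) \<in> (adjacency ?T')\<^sup>*"
        using step[of a b c] adjacency_rtrancl_sym[OF step[of b a c]] by blast
    qed
  qed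
  show ?thesis
    unfolding tour_subgraph_def connected_graph_def
  proof (intro conjI ballI)
    show "picks W \<subseteq> verts ?T'" using T by (auto simp: tour_subgraph_def switch_def)
    show "(x, y) \<in> (adjacency ?T')\<^sup>*" if "x \<in> verts ?T'" "y \<in> verts ?T'" for x y
      using adjacency_rtrancl_sym[OF w[OF that(1)]] w[OF that(2)] by (rule rtrancl_trans)
    show "subgraph ?T' G" by (fact sub)
    show "even (degree ?T' x)" for x by (fact deg)
  qed
qed

lemma length_switch:
  assumes T: "tour_subgraph W T"
  shows "tour_length W (switch T l j z) = tour_length W T
    + (\<Sum>p\<in>subaisle_gaps l j. signed_length T z p) + (\<Sum>p\<in>subaisle_gaps (Suc l) j. signed_length T z p)
    + signed_length T z (horizontal_gap l j) + signed_length T z (horizontal_gap l (Suc j))"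
proof -
  have "finite (toggled T l j z)" using finite_rectangle by (simp add: toggled_def)
  then have "tour_length W (switch T l j z) = tour_length W T
     + (\<Sum>e\<in>toggled T l j z. if e \<in> edges T then - edge_length W e else edge_length W e)"
    using sum_sym_diff_signed[OF tour_edges(1)[OF T]] by (simp add: tour_length_def switch_def)
  also have "(\<Sum>e\<in>toggled T l j z. if e \<in> edges T then - edge_length W e else edge_length W e)
      = (\<Sum>p\<in>rectangle l j. signed_length T z p)"
    unfolding sum_toggled by (intro sum.cong) (auto simp: signed_length_def gap_length_def copies_def)
  finally show ?thesis by (simp add: sum_rectangle)
qed

end

section \<open>Existence of minimal tours\<close>

lemma layout_sizes: "1 \<le> aisles W" "2 \<le> cross_aisles W"
  using rect by (auto simp: rectangular_warehouse_def)

lemma vertex_in_subaisle: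
  assumes "x \<in> V"
  obtains i j where "1 \<le> i" "i \<le> aisles W" "1 \<le> j" "j < cross_aisles W" "x \<in> subaisle i j"
  using assms
proof (cases rule: vertex_cases)
  case (Crossing i j)
  show thesis
  proof (cases "j < cross_aisles W")
    case True
    then show thesis using that[of i j] Crossing corners_in_subaisle(1)[of i j] by simp
  next
    case False
    then have "Suc (j - 1) = j" "1 \<le> j - 1" "j - 1 < cross_aisles W"
      using Crossing layout_sizes by auto
    then show thesis using that[of i "j - 1"] Crossing corners_in_subaisle(2)[of i "j - 1"] by simp
  qed
next
  case (Interior i j t)
  then show thesis using that[of i j] assms by (simp add: subaisle_def)
qed

lemma copies_G_subaisle_gaps: "p \<in> subaisle_gaps i j \<Longrightarrow> copies G p = UNIV"
  by (auto simp: copies_def edges_G subaisle_gaps_def)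

lemma G_connected_from_corner:
  assumes "x \<in> V"
  shows "(Crossing 1 1, x) \<in> (adjacency G)\<^sup>*"
proof -
  have top: "(Crossing 1 1, Crossing i 1) \<in> (adjacency G)\<^sup>*" if "1 \<le> i" "i \<le> aisles W" for i
    using that
  proof (induction i rule: dec_induct)
    case (step i)
    have "(Crossing i 1, Crossing (Suc i) 1) \<in> adjacency G"
      using step layout_sizes by (auto simp: adjacency_def edges_G horizontal_adj_iff)
    then show ?case using step by (auto intro: rtrancl_into_rtrancl)
  qed simp
  have inside: "(Crossing i j, x) \<in> (adjacency G)\<^sup>*"
    if "1 \<le> i" "i \<le> aisles W" "1 \<le> j" "j < cross_aisles W" "x \<in> subaisle i j" for i j x
    using that copies_G_subaisle_gaps by (intro connected_to_upper_end) auto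
  have left: "(Crossing i 1, Crossing i j) \<in> (adjacency G)\<^sup>*"
    if "1 \<le> i" "i \<le> aisles W" "1 \<le> j" "j \<le> cross_aisles W" for i j
    using that(3,4)
  proof (induction j rule: dec_induct)
    case (step j)
    then have "(Crossing i j, Crossing i (Suc j)) \<in> (adjacency G)\<^sup>*"
      using that by (intro inside corners_in_subaisle) auto
    then show ?case using step by (auto intro: rtrancl_trans)
  qed simp
  obtain i j where ij: "1 \<le> i" "i \<le> aisles W" "1 \<le> j" "j < cross_aisles W" "x \<in> subaisle i j"
    using assms by (rule vertex_in_subaisle)
  show ?thesis
    using rtrancl_trans[OF rtrancl_trans[OF top left] inside] ij by simp
qed

text \<open>This provides a tour to start from: in the full graph every gap is doubled, so all degrees are even.\<close>

lemma G_is_tour: "tour_subgraph W G"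
  unfolding tour_subgraph_def connected_graph_def
proof (intro conjI ballI)
  show "subgraph G G" using G_edge_ends by (auto simp: subgraph_def warehouse_graph_def)
  show "picks W \<subseteq> verts G" by (auto simp: warehouse_graph_def warehouse_vertices_def)
  show "(x, y) \<in> (adjacency G)\<^sup>*" if "x \<in> verts G" "y \<in> verts G" for x y
    using that G_connected_from_corner adjacency_rtrancl_sym[OF G_connected_from_corner]
    by (auto simp: warehouse_graph_def intro: rtrancl_trans)
  show "even (degree G x)" for x
  proof -
    define P where "P = {(u, v). vertical_adj W u v \<or> horizontal_adj W u v}"
    have E: "edges G = (\<Union>b. (\<lambda>p. (fst p, snd p, b)) ` P)"
      by (force simp: P_def warehouse_graph_def)
    have "P \<subseteq> V \<times> V" using G_edge_ends by (auto simp: P_def edges_G)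
    then have fin: "finite P" using finite_V finite_subset by blast
    have "degree G x = (\<Sum>e\<in>edges G. incidence x e)"
      using finite_edges_G G_edge_ends by (intro degree_eq_sum_incidence) auto
    also have "\<dots> = (\<Sum>b\<in>UNIV. \<Sum>e\<in>(\<lambda>p. (fst p, snd p, b)) ` P. incidence x e)"
      unfolding E using fin by (intro sum.UNION_disjoint) auto
    also have "\<dots> = (\<Sum>b\<in>(UNIV :: bool set). \<Sum>p\<in>P. incidence x (fst p, snd p, True))"
      by (intro sum.cong refl) (simp add: sum.reindex inj_on_def prod_eq_iff)
    finally show ?thesis by simp
  qed
qed

lemma minimal_tour_iff:
  "minimal_tour W T \<longleftrightarrow> tour_subgraph W T \<and> (\<forall>T'. tour_subgraph W T' \<longrightarrow> tour_length W T \<le> tour_length W T')"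
  by (auto simp: minimal_tour_def is_arg_min_def not_less)

lemma minimal_tour_exists: "\<exists>T. minimal_tour W T"
proof -
  have "{T. tour_subgraph W T} \<subseteq> (\<lambda>(A, B). \<lparr>verts = A, edges = B\<rparr>) ` (Pow V \<times> Pow (edges G))"
  proof
    fix T assume "T \<in> {T. tour_subgraph W T}"
    then have "T = (\<lambda>(A, B). \<lparr>verts = A, edges = B\<rparr>) (verts T, edges T)"
      "(verts T, edges T) \<in> Pow V \<times> Pow (edges G)"
      using tour_edges(5,6)[of T] by auto
    then show "T \<in> (\<lambda>(A, B). \<lparr>verts = A, edges = B\<rparr>) ` (Pow V \<times> Pow (edges G))"
      by (rule image_eqI)
  qed
  then have "finite {T. tour_subgraph W T}"
    using finite_V finite_edges_G by (auto intro: finite_subset)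
  then show ?thesis
    using ex_is_arg_min_if_finite[of "{T. tour_subgraph W T}" "tour_length W"] G_is_tour
    by (auto simp: minimal_tour_def)
qed

section \<open>Optimal tours\<close>

definition doubled :: "location multigraph \<Rightarrow> (nat \<times> nat) set" where
  "doubled T = {(i, j). i \<in> {1..aisles W} \<and> j \<in> {1..<cross_aisles W} \<and> doubled_subaisle W T i j}"

lemma doubled_iff_copies:
  "(i, j) \<in> doubled T \<longleftrightarrow> 1 \<le> i \<and> i \<le> aisles W \<and> 1 \<le> j \<and> j < cross_aisles W \<and> (\<forall>p\<in>subaisle_gaps i j. copies T p = UNIV)"
  by (auto simp: doubled_def doubled_iff)

lemma finite_doubled: "finite (doubled T)"
  by (rule finite_subset[of _ "{1..aisles W} \<times> {1..<cross_aisles W}"]) (auto simp: doubled_def)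

text \<open>The secondary criterion is what makes the exchange argument progress: an exchange that costs
  nothing must not destroy a doubled subaisle without creating another one.\<close>

definition optimal :: "location multigraph \<Rightarrow> bool" where
  "optimal T \<longleftrightarrow> minimal_tour W T \<and> (\<forall>T'. minimal_tour W T' \<longrightarrow> card (doubled T) \<le> card (doubled T'))"

lemma optimal_exists: "\<exists>T. optimal T"
  using ex_has_least_nat[of "minimal_tour W" _ "\<lambda>T. card (doubled T)"] minimal_tour_exists
  by (auto simp: optimal_def)

section \<open>Cutting off a dead end\<close>

text \<open>If all edges at \<open>v\<close> are the two copies of one gap, then contracting \<open>v\<close> into the other end of that
  gap maps every walk of \<open>T\<close> to a walk that avoids \<open>v\<close>.\<close>

lemma dead_end_removal:
  assumes T: "tour_subgraph W T" and p: "copies T p = UNIV" and v: "v = fst p \<or> v = snd p"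
    and notpick: "v \<notin> picks W"
    and sole: "\<And>a b c. (a, b, c) \<in> edges T \<Longrightarrow> a = v \<or> b = v \<Longrightarrow> (a, b) = p"
  shows "\<exists>T'. tour_subgraph W T' \<and> tour_length W T' < tour_length W T"
proof -
  define B where "B = (\<lambda>c. (fst p, snd p, c)) ` (UNIV :: bool set)"
  define T' where "T' = \<lparr>verts = verts T - {v}, edges = edges T - B\<rparr>"
  have BE: "B \<subseteq> edges T" using p by (auto simp: B_def copies_def)
  have sumB: "sum f B = f (fst p, snd p, True) + f (fst p, snd p, False)" for f :: "_ \<Rightarrow> 'b :: comm_monoid_add"
    by (simp add: B_def UNIV_bool ac_simps)
  have split: "sum f (edges T) = sum f (edges T') + sum f B" for f :: "_ \<Rightarrow> 'b :: comm_monoid_add"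
    using sum.subset_diff[OF BE tour_edges(1)[OF T], of f] by (simp add: T'_def)
  have ends: "fst p \<noteq> snd p" "fst p \<in> verts T" "snd p \<in> verts T"
  proof -
    have "(fst p, snd p, True) \<in> edges T" using BE by (auto simp: B_def)
    then show "fst p \<noteq> snd p" "fst p \<in> verts T" "snd p \<in> verts T"
      using tour_edges(3,4)[OF T] by blast+
  qed
  have off: "a \<noteq> v \<and> b \<noteq> v" if "(a, b, c) \<in> edges T'" for a b c
    using that sole[of a b c] by (auto simp: T'_def B_def)
  define u where "u = (if v = fst p then snd p else fst p)"
  define f where "f x = (if x = v then u else x)" for x
  have step: "(f a, f b) \<in> (adjacency T')\<^sup>*" if "(a, b, c) \<in> edges T" for a b c
  proof (cases "(a, b, c) \<in> B")
    case True
    then have "f a = f b" using v by (auto simp: B_def f_def u_def)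
    then show ?thesis by simp
  next
    case False
    then have *: "(a, b, c) \<in> edges T'" using that by (simp add: T'_def)
    then have "(a, b) \<in> adjacency T'" by (auto simp: adjacency_def)
    then show ?thesis using off[OF *] by (simp add: f_def)
  qed
  have "tour_subgraph W T'"
    unfolding tour_subgraph_def connected_graph_def
  proof (intro conjI ballI)
    show "subgraph T' G"
      unfolding subgraph_def
    proof (intro conjI)
      show "verts T' \<subseteq> verts G" using tour_edges(5)[OF T] by (auto simp: T'_def warehouse_graph_def)
      show "edges T' \<subseteq> edges G" using tour_edges(6)[OF T] by (auto simp: T'_def)
      show "\<forall>(a, b, c)\<in>edges T'. a \<in> verts T' \<and> b \<in> verts T'"
      proof clarify
        fix a b c assume *: "(a, b, c) \<in> edges T'"
        then have "(a, b, c) \<in> edges T" by (simp add: T'_def)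
        then show "a \<in> verts T' \<and> b \<in> verts T'"
          using off[OF *] tour_edges(4)[OF T, of a b c] by (simp add: T'_def)
      qed
    qed
    show "picks W \<subseteq> verts T'" using T notpick by (auto simp: tour_subgraph_def T'_def)
    fix x assume x: "x \<in> verts T'"
    show "(x, y) \<in> (adjacency T')\<^sup>*" if y: "y \<in> verts T'" for y
    proof -
      have "(x, y) \<in> (adjacency T)\<^sup>*" using tour_connected[OF T] x y by (simp add: T'_def)
      then have "(f x, f y) \<in> (adjacency T')\<^sup>*"
      proof (rule rtrancl_map)
        fix a b assume "(a, b) \<in> adjacency T"
        then obtain c where "(a, b, c) \<in> edges T \<or> (b, a, c) \<in> edges T"
          by (auto simp: adjacency_def)
        then show "(f a, f b) \<in> (adjacency T')\<^sup>*"
          using step[of a b c] adjacency_rtrancl_sym[OF step[of b a c]] by blast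
      qed
      then show ?thesis using x y by (simp add: f_def T'_def)
    qed
    have "degree T' x = (\<Sum>e\<in>edges T'. incidence x e)"
      using tour_edges(1,3)[OF T] by (intro degree_eq_sum_incidence) (auto simp: T'_def)
    then show "even (degree T' x)"
      using split[of "incidence x"] sumB[of "incidence x"] tour_degree[OF T, of x] tour_degree_even[OF T, of x]
      by simp
  qed
  moreover have "tour_length W T' < tour_length W T"
  proof -
    have "0 < edge_length W (fst p, snd p, c)" for c
      using BE tour_edges(6)[OF T] by (intro edge_length_pos) (auto simp: B_def)
    then show ?thesis
      using split[of "edge_length W"] sumB[of "edge_length W"]
      unfolding tour_length_def by (smt (verit))
  qed
  ultimately show ?thesis by blast
qed

section \<open>Moving a doubled subaisle to a neighbouring aisle\<close>

lemma signed_length_bounds: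
  assumes "0 \<le> gap_length p"
  shows "signed_length T z p \<le> gap_length p"
  using assms by (auto simp: signed_length_def)

lemma signed_length_doubled: "copies T p = UNIV \<Longrightarrow> signed_length T z p = - gap_length p"
  by (simp add: signed_length_def)

lemma signed_length_single: "copies T z = {b} \<Longrightarrow> signed_length T z z = - gap_length z"
  by (simp add: signed_length_def switch_copy_def)

lemma subaisle_gaps_disjoint:
  assumes "p \<in> subaisle_gaps q k" "p \<in> subaisle_gaps q' k'" "1 \<le> k" "k < cross_aisles W" "1 \<le> k'" "k' < cross_aisles W"
  shows "q = q' \<and> k = k'"
proof -
  have False if "p \<in> subaisle_gaps q k" "p \<in> subaisle_gaps q' k'" "1 \<le> k" "k < k'" "k' < cross_aisles W" for k k' q q'
    using that cross_depth_mono[of "Suc k" k'] by (auto simp: subaisle_gaps_def vertical_adj_def)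
  then have "k = k'" using assms by (metis linorder_cases)
  then show ?thesis using assms by (auto simp: subaisle_gaps_def)
qed

lemma horizontal_gap_notin_subaisle_gaps: "horizontal_gap l k \<notin> subaisle_gaps i j"
  by (auto simp: horizontal_gap_def subaisle_gaps_def vertical_adj_def)

lemma doubled_meets:
  assumes "tour_subgraph W T" "(i, j) \<in> doubled T"
  obtains w where "w \<in> verts T" "w \<in> subaisle i j"
proof -
  obtain p where p: "p \<in> subaisle_gaps i j"
    using assms subaisle_gaps_nonempty[of i j] by (auto simp: doubled_iff_copies)
  then have "copies T p \<noteq> {}" using assms by (auto simp: doubled_iff_copies)
  then show thesis
    using that[of "fst p"] used_gap_ends(1)[OF assms(1), of p] p subaisle_gaps_subset[of i j] by auto
qed

text \<open>In the following, \<open>i\<close> is the aisle with the doubled subaisle and \<open>i'\<close> its neighbour; \<open>l\<close> is the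
  left one of the two, so that both directions of moving are treated at once.\<close>

context
  fixes T :: "location multigraph" and l i i' j :: nat
  assumes opt: "optimal T"
    and l: "1 \<le> l" "l < aisles W"
    and sides: "i = l \<and> i' = Suc l \<or> i = Suc l \<and> i' = l"
    and D: "(i, j) \<in> doubled T"
begin

lemma j_bounds: "1 \<le> j" "j < cross_aisles W"
  using D by (auto simp: doubled_iff_copies)

lemma T_tour: "tour_subgraph W T"
  using opt by (simp add: optimal_def minimal_tour_iff)

lemma T_shortest: "tour_subgraph W T' \<Longrightarrow> tour_length W T \<le> tour_length W T'"
  using opt by (simp add: optimal_def minimal_tour_iff)

lemma switch_tour: "tour_subgraph W (switch T l j z)"
proof -
  obtain w where "w \<in> verts T" "w \<in> subaisle i j"
    using doubled_meets[OF T_tour D] .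
  then show ?thesis
    using sides by (intro switch_is_tour[OF l j_bounds T_tour]) auto
qed

text \<open>The doubled subaisle becomes single, which saves exactly its length.\<close>

lemma length_switch_doubled:
  "tour_length W (switch T l j z) = tour_length W T - subaisle_length W j
    + (\<Sum>p\<in>subaisle_gaps i' j. signed_length T z p)
    + signed_length T z (horizontal_gap l j) + signed_length T z (horizontal_gap l (Suc j))"
proof -
  have "(\<Sum>p\<in>subaisle_gaps i j. signed_length T z p) = (\<Sum>p\<in>subaisle_gaps i j. - gap_length p)"
    using D by (intro sum.cong) (auto simp: doubled_iff_copies signed_length_doubled)
  also have "\<dots> = - subaisle_length W j"
    using sum_gap_length_subaisle_gaps[of i j] j_bounds l sides by (simp add: sum_negf) linarith
  finally have "(\<Sum>p\<in>subaisle_gaps i j. signed_length T z p) = - subaisle_length W j" .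
  then show ?thesis
    using length_switch[OF l j_bounds T_tour, of z] sides by auto
qed

text \<open>All subaisles of a block have the same length, so the neighbour costs at most what is saved.\<close>

lemma sum_signed_le: "(\<Sum>p\<in>subaisle_gaps i' j. signed_length T z p) \<le> subaisle_length W j"
proof -
  have "(\<Sum>p\<in>subaisle_gaps i' j. signed_length T z p) \<le> (\<Sum>p\<in>subaisle_gaps i' j. gap_length p)"
    using gap_length_pos by (intro sum_mono signed_length_bounds less_imp_le)
  then show ?thesis using sum_gap_length_subaisle_gaps[of i' j] j_bounds l sides by auto
qed

lemma horizontal_gap_signed_le: "signed_length T z (horizontal_gap l k) \<le> aisle_gap W l"
  using signed_length_bounds[of "horizontal_gap l k" T z] aisle_gap_pos[OF l] by (simp add: gap_length_horizontal_gap)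

text \<open>One horizontal gap of the rectangle is used.  The switch can be arranged so that some horizontal gap
  loses an edge, and then the other one gains at most the same length.  The new tour is minimal; as it
  has lost the doubled subaisle \<open>(i, j)\<close>, it must have gained \<open>(i', j)\<close>, which can only
  happen if every gap there had exactly one edge.\<close>

lemma move_doubled:
  assumes k: "k = j \<or> k = Suc j" and used: "copies T (horizontal_gap l k) \<noteq> {}"
  shows "(\<forall>p\<in>subaisle_gaps i' j. \<exists>b. copies T p = {b}) \<and> (\<exists>T'. optimal T' \<and> (i', j) \<in> doubled T')"
proof -
  \<comment> \<open>A horizontal gap with a single edge loses this edge, which then counts as a saving.\<close>
  define z where "z = (if \<exists>b. copies T (horizontal_gap l j) = {b} then horizontal_gap l j else horizontal_gap l (Suc j))"
  let ?T' = "switch T l j z"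
  have "signed_length T z (horizontal_gap l j) = - aisle_gap W l \<or> signed_length T z (horizontal_gap l (Suc j)) = - aisle_gap W l"
  proof -
    have no_loss: "signed_length T z p = - gap_length p"
      if "copies T p = UNIV \<or> p = z \<and> (\<exists>b. copies T p = {b})" for p
      using that signed_length_doubled[of T p z] signed_length_single[of T p] by metis
    consider "\<exists>b. copies T (horizontal_gap l j) = {b}" | "copies T (horizontal_gap l j) = UNIV" | "copies T (horizontal_gap l j) = {}"
      using bool_set_cases[of "copies T (horizontal_gap l j)"] by metis
    then show ?thesis
    proof cases
      case 1
      then have "z = horizontal_gap l j" by (simp add: z_def)
      then show ?thesis using no_loss[of "horizontal_gap l j"] 1 by (simp add: gap_length_horizontal_gap)
    next
      case 2
      then show ?thesis using no_loss[of "horizontal_gap l j"] by (simp add: gap_length_horizontal_gap)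
    next
      case 3
      then have "z = horizontal_gap l (Suc j)" by (simp add: z_def)
      moreover have "copies T (horizontal_gap l (Suc j)) \<noteq> {}" using 3 k used by auto
      ultimately have "copies T (horizontal_gap l (Suc j)) = UNIV
          \<or> horizontal_gap l (Suc j) = z \<and> (\<exists>b. copies T (horizontal_gap l (Suc j)) = {b})"
        using bool_set_cases[of "copies T (horizontal_gap l (Suc j))"] by metis
      then show ?thesis using no_loss[of "horizontal_gap l (Suc j)"] by (simp add: gap_length_horizontal_gap)
    qed
  qed
  then have "tour_length W ?T' \<le> tour_length W T"
    using length_switch_doubled[of z] sum_signed_le[of z] horizontal_gap_signed_le[of z j] horizontal_gap_signed_le[of z "Suc j"]
    by linarith
  then have min': "minimal_tour W ?T'"
    using switch_tour[of z] by (auto simp: minimal_tour_iff intro: order_trans[OF _ T_shortest])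
  have znot: "z \<notin> subaisle_gaps q k" for q k by (simp add: z_def horizontal_gap_notin_subaisle_gaps)
  have in_rect: "subaisle_gaps i j \<subseteq> rectangle l j" "subaisle_gaps i' j \<subseteq> rectangle l j"
    using sides by (auto simp: rectangle_def)
  have not_i: "(i, j) \<notin> doubled ?T'"
  proof
    assume D': "(i, j) \<in> doubled ?T'"
    obtain p where p: "p \<in> subaisle_gaps i j"
      using D subaisle_gaps_nonempty[of i j] by (auto simp: doubled_iff_copies)
    then have "copies ?T' p = UNIV" "copies T p = UNIV" using D D' by (auto simp: doubled_iff_copies)
    then show False
      using copies_switch_full[of p l j z T] p in_rect znot[of i j] by (auto simp: UNIV_bool)
  qed
  have other: "(q, r) \<in> doubled T" if "(q, r) \<in> doubled ?T'" "(q, r) \<noteq> (i', j)" for q r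
  proof -
    have qr: "1 \<le> q" "q \<le> aisles W" "1 \<le> r" "r < cross_aisles W" using that by (auto simp: doubled_iff_copies)
    have "p \<notin> rectangle l j" if "p \<in> subaisle_gaps q r" for p
    proof
      assume "p \<in> rectangle l j"
      then have "p \<in> subaisle_gaps i j \<or> p \<in> subaisle_gaps i' j"
        using sides that horizontal_gap_notin_subaisle_gaps by (auto simp: rectangle_def)
      then have "(q, r) = (i, j) \<or> (q, r) = (i', j)"
        using subaisle_gaps_disjoint[OF that] qr j_bounds by blast
      then show False using not_i \<open>(q, r) \<in> doubled ?T'\<close> \<open>(q, r) \<noteq> (i', j)\<close> by auto
    qed
    then show ?thesis
      using that(1) copies_switch_outside[of _ l j T z] by (auto simp: doubled_iff_copies)
  qed
  then have sub: "doubled ?T' \<subseteq> insert (i', j) (doubled T - {(i, j)})" using not_i by auto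
  have less: "card (doubled T - {(i, j)}) < card (doubled T)"
    using D finite_doubled by (intro card_Diff1_less)
  have min_card: "card (doubled T) \<le> card (doubled T'')" if "minimal_tour W T''" for T''
    using opt that by (simp add: optimal_def)
  have D': "(i', j) \<in> doubled ?T'"
  proof (rule ccontr)
    assume "(i', j) \<notin> doubled ?T'"
    then have "doubled ?T' \<subseteq> doubled T - {(i, j)}" using sub by auto
    then have "card (doubled ?T') \<le> card (doubled T - {(i, j)})"
      using finite_doubled by (intro card_mono) auto
    then show False using less min_card[OF min'] by linarith
  qed
  have "card (doubled ?T') \<le> card (insert (i', j) (doubled T - {(i, j)}))"
    using sub finite_doubled by (intro card_mono) auto
  also have "\<dots> \<le> Suc (card (doubled T - {(i, j)}))"
    using finite_doubled by (simp add: card_insert_if)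
  also have "\<dots> \<le> card (doubled T)" using less by linarith
  finally have "optimal ?T'"
    using min' by (auto simp: optimal_def intro: order_trans[OF _ min_card])
  moreover have "\<exists>b. copies T p = {b}" if "p \<in> subaisle_gaps i' j" for p
  proof -
    have "p \<in> rectangle l j" "p \<noteq> z" "copies ?T' p = UNIV"
      using that in_rect(2) znot[of i' j] D' by (auto simp: doubled_iff_copies)
    then show ?thesis using copies_switch_full[of p l j z T] by blast
  qed
  ultimately show ?thesis using D' by blast
qed

text \<open>By \<open>move_doubled\<close> the neighbouring subaisle consists of single edges.  Giving up one gap \<open>z\<close> of it
  in the switch makes the exchange strictly profitable, since the doubled horizontal gap pays for the
  other one.\<close>

lemma horizontal_gap_not_doubled:
  assumes k: "k = j \<or> k = Suc j"
  shows "copies T (horizontal_gap l k) \<noteq> UNIV"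
proof
  assume full: "copies T (horizontal_gap l k) = UNIV"
  have single: "\<exists>b. copies T p = {b}" if "p \<in> subaisle_gaps i' j" for p
    using move_doubled[OF k] full that by simp
  obtain z where z: "z \<in> subaisle_gaps i' j"
    using subaisle_gaps_nonempty[of i' j] j_bounds l sides by auto
  have "(\<Sum>p\<in>subaisle_gaps i' j. signed_length T z p) < (\<Sum>p\<in>subaisle_gaps i' j. gap_length p)"
  proof (rule sum_strict_mono_ex1)
    show "\<forall>p\<in>subaisle_gaps i' j. signed_length T z p \<le> gap_length p"
      by (intro ballI signed_length_bounds less_imp_le gap_length_pos)
    obtain b where "copies T z = {b}" using single[OF z] by blast
    then have "signed_length T z z < gap_length z"
      using gap_length_pos[OF z] by (simp add: signed_length_single)
    then show "\<exists>p\<in>subaisle_gaps i' j. signed_length T z p < gap_length p" using z by blast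
  qed (rule finite_subaisle_gaps)
  then have "(\<Sum>p\<in>subaisle_gaps i' j. signed_length T z p) < subaisle_length W j"
    using sum_gap_length_subaisle_gaps[of i' j] j_bounds l sides by auto
  moreover have "signed_length T z (horizontal_gap l k) = - aisle_gap W l"
    using signed_length_doubled[OF full] by (simp add: gap_length_horizontal_gap)
  ultimately have "tour_length W (switch T l j z) < tour_length W T"
    using k length_switch_doubled[of z] horizontal_gap_signed_le[of z j] horizontal_gap_signed_le[of z "Suc j"] by auto
  then show False using T_shortest[OF switch_tour, of z] by simp
qed

end

section \<open>Doubled subaisles next to the boundary\<close>

text \<open>The crossings on cross-aisle \<open>k\<close> are ends of the subaisles of block \<open>j\<close> on the boundary of the
  warehouse, so that they have only one vertical neighbour.\<close>

definition outer :: "nat \<Rightarrow> nat \<Rightarrow> bool" where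
  "outer j k \<longleftrightarrow> j = 1 \<and> k = 1 \<or> Suc j = cross_aisles W \<and> k = cross_aisles W"

lemma depth_bounds:
  assumes "x \<in> V"
  shows "cross_depth 1 \<le> depth W x" "depth W x \<le> cross_depth (cross_aisles W)"
proof -
  obtain i j where ij: "1 \<le> j" "j < cross_aisles W" and x: "x \<in> subaisle i j"
    using assms vertex_in_subaisle by metis
  have "cross_depth 1 \<le> cross_depth j" "cross_depth (Suc j) \<le> cross_depth (cross_aisles W)" using ij cross_depth_mono[of 1 j] cross_depth_mono[of "Suc j" "cross_aisles W"] by auto
  then show "cross_depth 1 \<le> depth W x" "depth W x \<le> cross_depth (cross_aisles W)" using x by (auto simp: subaisle_def)
qed

lemma outer_gap:
  assumes ij: "1 \<le> i" "i \<le> aisles W" "1 \<le> j" "j < cross_aisles W" and o: "outer j k"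
  obtains p where "p \<in> subaisle_gaps i j" "Crossing i k = fst p \<or> Crossing i k = snd p"
    "\<And>a b. vertical_adj W a b \<Longrightarrow> a = Crossing i k \<or> b = Crossing i k \<Longrightarrow> (a, b) = p"
proof -
  from o consider "j = 1" "k = 1" | "Suc j = cross_aisles W" "k = cross_aisles W"
    by (auto simp: outer_def)
  then show thesis
  proof cases
    case 1
    have "Crossing i j \<in> fst ` subaisle_gaps i j"
      using bij_betw_fst_subaisle_gaps[OF ij] corners_in_subaisle(1)[OF ij] by (auto simp: bij_betw_def)
    then obtain w where w: "(Crossing i j, w) \<in> subaisle_gaps i j" by auto
    show thesis
    proof (rule that[OF w])
      fix a b assume ab: "vertical_adj W a b" "a = Crossing i k \<or> b = Crossing i k"
      have "b \<noteq> Crossing i k"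
        using ab(1) depth_bounds(1)[of a] 1 by (auto simp: vertical_adj_def)
      then show "(a, b) = (Crossing i j, w)"
        using ab w 1 vertical_adj_unique_below[of a b w] by (auto simp: subaisle_gaps_def)
    qed (use 1 in simp)
  next
    case 2
    have "Crossing i (Suc j) \<in> snd ` subaisle_gaps i j"
      using bij_betw_snd_subaisle_gaps[OF ij] corners_in_subaisle(2)[OF ij] by (auto simp: bij_betw_def)
    then obtain w where w: "(w, Crossing i (Suc j)) \<in> subaisle_gaps i j" by auto
    show thesis
    proof (rule that[OF w])
      fix a b assume ab: "vertical_adj W a b" "a = Crossing i k \<or> b = Crossing i k"
      have "a \<noteq> Crossing i k"
        using ab(1) depth_bounds(2)[of b] 2 by (auto simp: vertical_adj_def)
      then show "(a, b) = (w, Crossing i (Suc j))"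
        using ab w 2 vertical_adj_unique_above[of a b w] by (auto simp: subaisle_gaps_def)
    qed (use 2 in simp)
  qed
qed

lemma tour_horizontal:
  assumes "tour_subgraph W T" "copies T (horizontal_gap l k) \<noteq> {}"
  shows "1 \<le> l" "l < aisles W"
proof -
  obtain b where "(Crossing l k, Crossing (Suc l) k, b) \<in> edges G"
    using assms tour_edges(2)[OF assms(1)] by (auto simp: copies_def horizontal_gap_def)
  then show "1 \<le> l" "l < aisles W"
    by (auto simp: edges_G horizontal_adj_iff vertical_adj_def)
qed

lemma optimal_tour: "optimal T \<Longrightarrow> tour_subgraph W T"
  by (simp add: optimal_def minimal_tour_iff)

lemma tour_edge_at_crossing:
  assumes "tour_subgraph W T" "(a, b, c) \<in> edges T" "a = Crossing i k \<or> b = Crossing i k"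
  shows "vertical_adj W a b \<or> (a, b) = horizontal_gap i k \<or> 1 \<le> i \<and> (a, b) = horizontal_gap (i - 1) k"
  using tour_edges(2)[OF assms(1,2)] assms(3)
  by (auto simp: edges_G horizontal_adj_iff horizontal_gap_def)

lemma card_edge_copies: "card ((\<lambda>c. (fst p, snd p, c)) ` copies T p) = card (copies T p)"
  by (rule card_image) (simp add: inj_on_def)

text \<open>Suppose that one side of the outer end is bare.  Then the gap on the other side has even
  multiplicity, because the doubled subaisle contributes two to the even degree.  Multiplicity zero makes
  the outer end a dead end, which a minimal tour has only at the depot, and multiplicity two contradicts
  \<open>horizontal_gap_not_doubled\<close>.\<close>

lemma doubled_reaches_both_sides:
  assumes opt: "optimal T" and D: "(i, j) \<in> doubled T" and o: "outer j k"
    and nodepot: "Crossing i k \<noteq> depot W"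
  shows "copies T (horizontal_gap (i - 1) k) \<noteq> {}" "copies T (horizontal_gap i k) \<noteq> {}"
proof -
  let ?v = "Crossing i k"
  note T = optimal_tour[OF opt]
  have ij: "1 \<le> i" "i \<le> aisles W" "1 \<le> j" "j < cross_aisles W"
    using D by (auto simp: doubled_iff_copies)
  have k: "k = j \<or> k = Suc j" using o by (auto simp: outer_def)
  obtain p where p: "p \<in> subaisle_gaps i j" "?v = fst p \<or> ?v = snd p"
    and sole: "\<And>a b. vertical_adj W a b \<Longrightarrow> a = ?v \<or> b = ?v \<Longrightarrow> (a, b) = p"
    using outer_gap[OF ij o] by blast
  have full: "copies T p = UNIV" using D p by (auto simp: doubled_iff_copies)
  have False if l: "l = i - 1 \<and> l' = i \<or> l = i \<and> l' = i - 1" and empty: "copies T (horizontal_gap l' k) = {}" for l l'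
  proof -
    let ?g = "horizontal_gap l k"
    have ends: "(a, b) = p \<or> (a, b) = ?g" if "(a, b, c) \<in> edges T" "a = ?v \<or> b = ?v" for a b c
    proof -
      have "c \<in> copies T (a, b)" using that(1) by (simp add: copies_def)
      then have "(a, b) \<noteq> horizontal_gap l' k" using empty by auto
      then show ?thesis using tour_edge_at_crossing[OF T that] sole[of a b] that(2) l by auto
    qed
    have pg: "p \<noteq> ?g" using p horizontal_gap_notin_subaisle_gaps by blast
    have at_g: "fst ?g = ?v \<or> snd ?g = ?v" if "copies T ?g \<noteq> {}"
      using l ij tour_horizontal(1)[OF T that] by (auto simp: horizontal_gap_def)
    let ?P = "(\<lambda>c. (fst p, snd p, c)) ` copies T p" and ?Q = "(\<lambda>c. (fst ?g, snd ?g, c)) ` copies T ?g"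
    have "{(a, b, c) \<in> edges T. a = ?v \<or> b = ?v} = ?P \<union> ?Q"
    proof (intro equalityI subsetI)
      fix e assume "e \<in> {(a, b, c) \<in> edges T. a = ?v \<or> b = ?v}"
      then obtain a b c where e: "e = (a, b, c)" "(a, b, c) \<in> edges T" "a = ?v \<or> b = ?v" by blast
      have c: "c \<in> copies T (a, b)" using e(2) by (simp add: copies_def)
      have "e \<in> (\<lambda>c. (fst (a, b), snd (a, b), c)) ` copies T (a, b)"
        using c by (intro image_eqI[of _ _ c]) (simp_all add: e(1))
      with ends[OF e(2,3)] show "e \<in> ?P \<union> ?Q" by (elim disjE) simp_all
    next
      fix e assume "e \<in> ?P \<union> ?Q"
      then obtain q where q': "e \<in> (\<lambda>c. (fst q, snd q, c)) ` copies T q" "q = p \<or> q = ?g"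
        by (elim UnE) simp_all
      then obtain c where q: "e = (fst q, snd q, c)" "c \<in> copies T q" by (elim imageE)
      have "fst q = ?v \<or> snd q = ?v" using q'(2) q(2) p(2) at_g by (elim disjE) auto
      then show "e \<in> {(a, b, c) \<in> edges T. a = ?v \<or> b = ?v}"
        using q(1,2) by (simp add: copies_def)
    qed
    then have "degree T ?v = card (?P \<union> ?Q)" by (simp add: degree_def)
    also have "\<dots> = card ?P + card ?Q"
    proof (rule card_Un_disjoint)
      show "?P \<inter> ?Q = {}"
      proof (rule equals0I)
        fix e assume "e \<in> ?P \<inter> ?Q"
        then have "fst p = fst ?g" "snd p = snd ?g" by force+
        then show False using pg prod_eqI by metis
      qed
    qed simp_all
    also have "card ?P = 2" using card_edge_copies[of p T] by (simp only: full card_UNIV_bool)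
    finally have "degree T ?v = 2 + card (copies T ?g)" by (simp only: card_edge_copies)
    then have "even (card (copies T ?g))" using tour_degree_even[OF T, of ?v] by simp
    then consider "copies T ?g = {}" | "copies T ?g = UNIV"
      using bool_set_cases[of "copies T ?g"] by (elim disjE) simp_all
    then show False
    proof cases
      case 1
      have "?v \<notin> picks W"
        using rect nodepot by (auto simp: rectangular_warehouse_def subaisle_interior_def)
      moreover have "(a, b) = p" if "(a, b, c) \<in> edges T" "a = ?v \<or> b = ?v" for a b c
      proof -
        have "c \<in> copies T (a, b)" using that(1) by (simp add: copies_def)
        then show ?thesis using ends[OF that] 1 by (elim disjE) simp_all
      qed
      ultimately show False
        using dead_end_removal[OF T full p(2)] opt by (auto simp: optimal_def minimal_tour_iff)
    next
      case 2
      then have "1 \<le> l" "l < aisles W" using tour_horizontal[OF T, of l k] by auto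
      moreover obtain i' where "i = l \<and> i' = Suc l \<or> i = Suc l \<and> i' = l"
        using l ij by (cases "i = l") auto
      ultimately show False
        using horizontal_gap_not_doubled[OF opt _ _ _ D k, of l i'] 2 by blast
    qed
  qed
  then show "copies T (horizontal_gap (i - 1) k) \<noteq> {}" "copies T (horizontal_gap i k) \<noteq> {}" by blast+
qed

text \<open>The outer end is never the depot, so there is always a horizontal edge leading further away along
  which the doubled subaisle can be moved; but the number of aisles is finite.\<close>

lemma not_doubled_right_of_depot:
  assumes "optimal T" "(i, j) \<in> doubled T" "outer j k" "aisle_of (depot W) < i"
  shows False
  using assms
proof (induction "aisles W - i" arbitrary: i T rule: less_induct)
  case less
  have "Crossing i k \<noteq> depot W" using less.prems(4) by (metis aisle_of.simps(1) less_irrefl)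
  then have used: "copies T (horizontal_gap i k) \<noteq> {}"
    by (rule doubled_reaches_both_sides(2)[OF less.prems(1-3)])
  have i: "1 \<le> i" "i < aisles W"
    using tour_horizontal[OF optimal_tour[OF less.prems(1)] used] by auto
  have "k = j \<or> k = Suc j" using less.prems(3) by (auto simp: outer_def)
  then obtain T' where "optimal T'" "(Suc i, j) \<in> doubled T'"
    using move_doubled[OF less.prems(1) i _ less.prems(2) _ used, of "Suc i"] by auto
  moreover have "aisles W - Suc i < aisles W - i" using i by linarith
  ultimately show False using less.hyps[of "Suc i" T'] less.prems by simp
qed

lemma not_doubled_left_of_depot:
  assumes "optimal T" "(i, j) \<in> doubled T" "outer j k" "i < aisle_of (depot W)"
  shows False
  using assms
proof (induction i arbitrary: T)
  case 0
  then show False by (simp add: doubled_iff_copies)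
next
  case (Suc i)
  have "Crossing (Suc i) k \<noteq> depot W" using Suc.prems(4) by (metis aisle_of.simps(1) less_irrefl)
  then have used: "copies T (horizontal_gap i k) \<noteq> {}"
    using doubled_reaches_both_sides(1)[OF Suc.prems(1-3)] by simp
  have i: "1 \<le> i" "i < aisles W"
    using tour_horizontal[OF optimal_tour[OF Suc.prems(1)] used] by auto
  have "k = j \<or> k = Suc j" using Suc.prems(3) by (auto simp: outer_def)
  then obtain T' where "optimal T'" "(i, j) \<in> doubled T'"
    using move_doubled[OF Suc.prems(1) i _ Suc.prems(2) _ used, of i] by auto
  then show False using Suc.IH[of T'] Suc.prems by auto
qed

text \<open>A horizontal edge at one of the ends would allow moving the doubled subaisle to an aisle other than
  that of the depot, and no optimal tour has a doubled subaisle there.\<close>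

lemma doubled_hangs_from_depot:
  assumes opt: "optimal T" and D: "(i, j) \<in> doubled T" and o: "outer j k"
  shows "depot W = Crossing i k"
    and "r = j \<or> r = Suc j \<Longrightarrow> copies T (horizontal_gap i r) = {} \<and> copies T (horizontal_gap (i - 1) r) = {}"
proof -
  have i: "aisle_of (depot W) = i"
    using not_doubled_right_of_depot[OF opt D o] not_doubled_left_of_depot[OF opt D o] linorder_neqE by blast
  have none: "copies T (horizontal_gap i r) = {} \<and> copies T (horizontal_gap (i - 1) r) = {}" if r: "r = j \<or> r = Suc j" for r
  proof (rule ccontr)
    assume "\<not> ?thesis"
    then consider "copies T (horizontal_gap i r) \<noteq> {}" | "copies T (horizontal_gap (i - 1) r) \<noteq> {}" by blast
    then show False
    proof cases
      case 1
      obtain T' where "optimal T'" "(Suc i, j) \<in> doubled T'"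
        using move_doubled[OF opt tour_horizontal[OF optimal_tour[OF opt] 1] _ D r 1, of "Suc i"] by auto
      then show False using not_doubled_right_of_depot[of T' "Suc i" j k] o i by auto
    next
      case 2
      have "1 \<le> i - 1" using tour_horizontal(1)[OF optimal_tour[OF opt] 2] .
      then obtain T' where "optimal T'" "(i - 1, j) \<in> doubled T'"
        using move_doubled[OF opt tour_horizontal[OF optimal_tour[OF opt] 2] _ D r 2, of "i - 1"] by auto
      then show False using not_doubled_left_of_depot[of T' "i - 1" j k] o i \<open>1 \<le> i - 1\<close> by auto
    qed
  qed
  then show "r = j \<or> r = Suc j \<Longrightarrow> copies T (horizontal_gap i r) = {} \<and> copies T (horizontal_gap (i - 1) r) = {}" .
  have "k = j \<or> k = Suc j" using o by (auto simp: outer_def)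
  then show "depot W = Crossing i k"
    using doubled_reaches_both_sides(2)[OF opt D o] none by metis
qed

section \<open>The second block\<close>

text \<open>The part \<open>X\<close> of the aisle on one side of the gap \<open>p\<close> has no horizontal edges, so that \<open>p\<close> is the only
  connection from \<open>X\<close> to the rest of the tour.\<close>

lemma hanging_gap_doubled:
  assumes T: "tour_subgraph W T" and p: "p \<in> subaisle_gaps i j"
    and X: "X = {x \<in> V. aisle_of x = i \<and> depth W x \<le> depth W (fst p)}
      \<or> X = {x \<in> V. aisle_of x = i \<and> depth W (snd p) \<le> depth W x}"
    and bare: "\<And>r. Crossing i r \<in> X \<Longrightarrow> copies T (horizontal_gap i r) = {} \<and> copies T (horizontal_gap (i - 1) r) = {}"
    and x: "x \<in> X" "x \<in> verts T" and y: "y \<in> verts T" "aisle_of y \<noteq> i"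
  shows "copies T p = UNIV"
proof (rule sole_cut_gap_is_doubled[OF tour_edges(1)[OF T]])
  have p': "vertical_adj W (fst p) (snd p)" "aisle_of (fst p) = i" "aisle_of (snd p) = i"
    using p by (auto simp: subaisle_gaps_def vertical_adj_def)
  show "finite X" using X finite_V by auto
  show "(x, y) \<in> (adjacency T)\<^sup>*" using tour_connected[OF T] x y by blast
  show "y \<notin> X" using X y by auto
  show "(fst p \<in> X) \<noteq> (snd p \<in> X)" using X p' by (auto simp: vertical_adj_def)
  show "x \<in> X" by fact
  show "u \<noteq> v" if "(u, v, b) \<in> edges T" for u v b using tour_edges(3)[OF T that] .
  show "even (degree T x)" for x by (rule tour_degree_even[OF T])
  fix a b c assume e: "(a, b, c) \<in> edges T" and cut: "(a \<in> X) \<noteq> (b \<in> X)"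
  show "(a, b) = p"
  proof (cases "vertical_adj W a b")
    case True
    have "aisle_of a = i" "aisle_of b = i" using True cut X by (auto simp: vertical_adj_def)
    then have "depth W a \<le> depth W (fst p)" "depth W (snd p) \<le> depth W b"
      using True cut X p' by (auto simp: vertical_adj_def)
    then have "depth W a = depth W (fst p)"
      using True p' \<open>aisle_of a = i\<close> unfolding vertical_adj_def by (smt (verit))
    then have "a = fst p"
      using depth_inj[of a "fst p"] True p' \<open>aisle_of a = i\<close> by (auto simp: vertical_adj_def)
    then show ?thesis using vertical_adj_unique_below[of a b "snd p"] True p' by (auto simp: prod_eq_iff)
  next
    case False
    then obtain l r where ab: "(a, b) = horizontal_gap l r" "1 \<le> l"
      using tour_edges(2)[OF T e] by (auto simp: edges_G horizontal_adj_iff horizontal_gap_def)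
    have used: "copies T (horizontal_gap l r) \<noteq> {}" using e ab(1) by (auto simp: copies_def horizontal_gap_def)
    have "aisle_of a = i \<and> a \<in> X \<or> aisle_of b = i \<and> b \<in> X" using cut X by auto
    then have "Crossing i r \<in> X \<and> (l = i \<or> l = i - 1)" using ab by (auto simp: horizontal_gap_def)
    then show ?thesis using bare used by auto
  qed
qed

text \<open>With two blocks, \<open>3 - j\<close> is the other block, and \<open>4 - k\<close> is the outer cross-aisle opposite to \<open>k\<close>.\<close>

lemma no_doubled_subaisle:
  assumes opt: "optimal T"
    and n: "cross_aisles W = 2 \<or> cross_aisles W = 3 \<and> 2 \<le> card (nonempty_aisles W)"
  shows "doubled T = {}"
proof (rule ccontr)
  assume "doubled T \<noteq> {}"
  then obtain i j where D: "(i, j) \<in> doubled T" by auto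
  then have ij: "1 \<le> i" "i \<le> aisles W" "1 \<le> j" "j < cross_aisles W" by (auto simp: doubled_iff_copies)
  note T = optimal_tour[OF opt]
  from n show False
  proof
    assume "cross_aisles W = 2"
    then have "outer j 1" "outer j 2" using ij by (auto simp: outer_def)
    then have "depot W = Crossing i 1" "depot W = Crossing i 2"
      using doubled_hangs_from_depot(1)[OF opt D] by blast+
    then show False by simp
  next
    assume n3: "cross_aisles W = 3 \<and> 2 \<le> card (nonempty_aisles W)"
    define k where "k = (if j = 1 then 1 else 3 :: nat)"
    have jk: "j = 1 \<and> k = 1 \<or> j = 2 \<and> k = 3" using ij n3 by (auto simp: k_def)
    have ok: "outer j k" "outer (3 - j) (4 - k)" using jk n3 by (auto simp: outer_def)
    note depot = doubled_hangs_from_depot(1)[OF opt D ok(1)]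
    have "\<not> nonempty_aisles W \<subseteq> {i}"
      using n3 card_mono[of "{i}" "nonempty_aisles W"] by auto
    then obtain y where y: "y \<in> picks W" "aisle_of y \<noteq> i" by (auto simp: nonempty_aisles_def)
    have picks: "picks W \<subseteq> verts T" using T by (simp add: tour_subgraph_def)
    have depotT: "depot W \<in> verts T" using picks rect by (auto simp: rectangular_warehouse_def)
    have "copies T p = UNIV" if p: "p \<in> subaisle_gaps i (3 - j)" for p
    proof -
      have dp: "depth W (fst p) < depth W (snd p)" using p by (auto simp: subaisle_gaps_def vertical_adj_def)
      \<comment> \<open>The part of the aisle on that side of \<open>p\<close> on which the depot lies.\<close>
      define X where "X = (if j = 1 then {x \<in> V. aisle_of x = i \<and> depth W x \<le> depth W (fst p)}
        else {x \<in> V. aisle_of x = i \<and> depth W (snd p) \<le> depth W x})"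
      have reach: "r = j \<or> r = Suc j" if r: "Crossing i r \<in> X" for r
      proof (rule ccontr)
        have rV: "1 \<le> r" "r \<le> 3" using r n3 by (auto simp: X_def split: if_splits)
        assume "\<not> ?thesis"
        then have "j = 1 \<and> r = 3 \<or> j = 2 \<and> r = 1" using rV jk by auto
        then show False using r p dp by (auto simp: X_def subaisle_gaps_def eval_nat_numeral)
      qed
      show ?thesis
      proof (rule hanging_gap_doubled[OF T p])
        show "X = {x \<in> V. aisle_of x = i \<and> depth W x \<le> depth W (fst p)}
          \<or> X = {x \<in> V. aisle_of x = i \<and> depth W (snd p) \<le> depth W x}" by (simp add: X_def)
        show "copies T (horizontal_gap i r) = {} \<and> copies T (horizontal_gap (i - 1) r) = {}" if "Crossing i r \<in> X" for r
          using doubled_hangs_from_depot(2)[OF opt D ok(1) reach[OF that]] .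
        have "fst p \<in> V" "snd p \<in> V" using p by (auto simp: subaisle_gaps_def vertical_adj_def)
        then have "depth W (Crossing i 1) \<le> depth W (fst p)" "depth W (snd p) \<le> depth W (Crossing i 3)"
          using depth_bounds[of "fst p"] depth_bounds[of "snd p"] n3 by auto
        then show "depot W \<in> X"
          using depot jk ij n3 by (auto simp: X_def)
      qed (use depotT y picks in auto)
    qed
    then have "(i, 3 - j) \<in> doubled T" using ij n3 by (auto simp: doubled_iff_copies)
    then have "depot W = Crossing i (4 - k)"
      using doubled_hangs_from_depot(1)[OF opt _ ok(2)] by blast
    then show False using depot jk by auto
  qed
qed

end

theorem corollary1:
  fixes W :: warehouse
  assumes "rectangular_warehouse W"
    and "cross_aisles W = 2 \<or> (cross_aisles W = 3 \<and> 2 \<le> card (nonempty_aisles W))"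
  shows "\<exists>T. minimal_tour W T \<and> \<not> (\<exists>i j k. double_edge W T i j k)"
proof -
  interpret warehouse_layout W by standard fact
  obtain T where T: "optimal T" using optimal_exists by blast
  have "\<not> double_edge W T i j k" for i j k
    using no_doubled_subaisle[OF T assms(2)] double_edge_iff_doubled_subaisle[of W T i j]
    by (auto simp: doubled_def)
  then show ?thesis using T by (auto simp: optimal_def)
qed

end
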